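(* There is a set $X \subseteq \omega^{\uparrow\omega}$ with $X \in s^0$ and $X \notin m^0$, i.e. $s^0 \setminus m^0 \neq \emptyset$.
   Context: $\omega^{\uparrow<\omega}$ denotes the set of strictly increasing finite sequences of natural numbers and $\omega^{\uparrow\omega}$ the set of strictly increasing infinite sequences of natural numbers. A tree is a nonempty subset $T\subseteq\omega^{\uparrow<\omega}$ closed under initial segments; $[T]$ is the set of $f\in\omega^{\uparrow\omega}$ all of whose finite initial segments lie in $T$. For a family $\mathbb P$ of trees, the associated ideal consists of all $X\subseteq\omega^{\uparrow\omega}$ such that for every $T\in\mathbb P$ there is $T'\in\mathbb P$ with $T'\subseteq T$ and $[T']\cap X=\emptyset$. A Sacks tree is a tree $T$ such that every node of $T$ has an extension in $T$ with at least two immediate successors in $T$; $s^0$ is the ideal associated with the Sacks trees. A Miller tree is a tree $T$ such that every node of $T$ has an extension in $T$ with infinitely many immediate successors in $T$; $m^0$ is the ideal associated with the Miller trees. *)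

theory Defs
  imports Main "HOL-Library.Sublist"
begin

definition inc_fin_seqs :: "nat list set" where
  "inc_fin_seqs = {s. sorted_wrt (<) s}"

definition inc_inf_seqs :: "(nat \<Rightarrow> nat) set" where
  "inc_inf_seqs = {f. strict_mono f}"

definition is_tree :: "nat list set \<Rightarrow> bool" where
  "is_tree T \<longleftrightarrow> T \<noteq> {} \<and> T \<subseteq> inc_fin_seqs \<and> (\<forall>t\<in>T. \<forall>s. prefix s t \<longrightarrow> s \<in> T)"

definition branches :: "nat list set \<Rightarrow> (nat \<Rightarrow> nat) set" where
  "branches T = {f \<in> inc_inf_seqs. \<forall>n. map f [0..<n] \<in> T}"

definition imm_succs :: "nat list set \<Rightarrow> nat list \<Rightarrow> nat list set" where
  "imm_succs T s = {t \<in> T. \<exists>k. t = s @ [k]}"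

definition assoc_ideal :: "nat list set set \<Rightarrow> (nat \<Rightarrow> nat) set set" where
  "assoc_ideal P = {X. X \<subseteq> inc_inf_seqs \<and>
     (\<forall>T\<in>P. \<exists>T'\<in>P. T' \<subseteq> T \<and> branches T' \<inter> X = {})}"

(* "Extension" is non-strict: a splitting node may be its own extension. A splitting node has
   successors in the tree, so the strict reading gives the same families of trees. *)
definition sacks_trees :: "nat list set set" where
  "sacks_trees = {T. is_tree T \<and>
     (\<forall>s\<in>T. \<exists>t\<in>T. prefix s t \<and> (\<exists>u\<in>imm_succs T t. \<exists>v\<in>imm_succs T t. u \<noteq> v))}"

definition miller_trees :: "nat list set set" where
  "miller_trees = {T. is_tree T \<and>
     (\<forall>s\<in>T. \<exists>t\<in>T. prefix s t \<and> infinite (imm_succs T t))}"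

definition s0 :: "(nat \<Rightarrow> nat) set set" where
  "s0 = assoc_ideal sacks_trees"

definition m0 :: "(nat \<Rightarrow> nat) set set" where
  "m0 = assoc_ideal miller_trees"

end

theory Submission
  imports Defs "HOL-Library.Countable_Set"
begin

text \<open>
  Let \<open>\<Phi>\<close> be an everywhere-dominating family of functions of least cardinality, well-ordered in order
  type its cardinal. Every proper initial segment of \<open>\<Phi>\<close> then fails to dominate, so one finds compact
  sets \<open>C \<xi>\<close> (\<open>\<xi> \<in> \<Phi>\<close>) covering all compact sets such that every Miller tree \<open>T\<close> has, for some \<open>\<xi>\<close>,
  branches in \<open>C \<xi>\<close> outside all \<open>C \<zeta>\<close> with \<open>\<zeta>\<close> before \<open>\<xi>\<close>. Moreover there is a continuous coding map
  \<open>F \<xi>\<close>, depending on \<open>\<xi>\<close> only, that takes every value \<open>\<eta>\<close> on continuum many of these branches. The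
  level \<open>\<xi>\<close> of a branch is not a Borel function of it; a single Borel coding map cannot work, since it
  is constant or injective on the branches of some Miller subtree.

  A Sacks tree has a subtree contained in a single \<open>C \<xi>\<close>, meeting each earlier \<open>C \<zeta>\<close> in a countable set,
  on which \<open>F \<xi>\<close> is constant or has countable fibres. Fewer than continuum many such thin trees never
  cover \<open>T\<close>: choose \<open>\<eta>\<close> different from all constant values, and then each of them contains only
  countably many of the branches of \<open>T\<close> of level \<open>\<xi>\<close> with code \<open>\<eta>\<close>. Choosing for each Miller tree a
  branch off the thin trees that precede it in a well-order of type continuum gives a set that is not
  in \<open>m0\<close> and meets every thin tree in fewer than continuum many points; as a Sacks tree splits into
  continuum many disjoint ones, the set is in \<open>s0\<close>.
\<close>

unbundle cardinal_syntax

subsection \<open>Trees and branches\<close>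

lemma inc_inf_seqs_ge:
  assumes "x \<in> inc_inf_seqs"
  shows "n \<le> x n"
  using assms by (simp add: inc_inf_seqs_def strict_mono_imp_increasing)

lemma map_upt_in_inc_fin_seqs:
  assumes "x \<in> inc_inf_seqs"
  shows "map x [0..<n] \<in> inc_fin_seqs"
  using assms
  by (auto simp: inc_inf_seqs_def inc_fin_seqs_def sorted_wrt_iff_nth_less strict_mono_def)

lemma map_upt_eq_iff: "map x [0..<n] = map y [0..<n] \<longleftrightarrow> (\<forall>i<n. x i = y i)"
  by (auto simp: list_eq_iff_nth_eq)

lemma prefix_map_upt_iff:
  "prefix s (map x [0..<n]) \<longleftrightarrow> length s \<le> n \<and> map x [0..<length s] = s"
proof
  assume "prefix s (map x [0..<n])"
  then obtain u where u: "map x [0..<n] = s @ u" by (auto simp: prefix_def)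
  then have "length s \<le> n" by (metis le_add1 length_append length_map length_upt minus_nat.diff_0)
  moreover have "take (length s) (map x [0..<n]) = s" using u by simp
  ultimately show "length s \<le> n \<and> map x [0..<length s] = s" by (simp add: take_map)
next
  assume "length s \<le> n \<and> map x [0..<length s] = s"
  then have "take (length s) (map x [0..<n]) = s" by (simp add: take_map)
  then show "prefix s (map x [0..<n])" by (metis take_is_prefix)
qed

lemma branches_mono: "T \<subseteq> T' \<Longrightarrow> branches T \<subseteq> branches T'"
  by (auto simp: branches_def)

lemma Nil_in_tree: "is_tree T \<Longrightarrow> [] \<in> T"
  unfolding is_tree_def using Nil_prefix by blast

lemma tree_prefix_closed: "is_tree T \<Longrightarrow> t \<in> T \<Longrightarrow> prefix s t \<Longrightarrow> s \<in> T"
  by (auto simp: is_tree_def)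

lemma branch_of_chain:
  assumes T: "is_tree T" and t: "\<And>i. t i \<in> T" and chain: "\<And>i. strict_prefix (t i) (t (Suc i))"
  obtains x where "x \<in> branches T" and "\<And>i. map x [0..<length (t i)] = t i"
    and "\<And>i. i \<le> length (t i)"
proof -
  \<comment> \<open>\<open>t n\<close> may have length exactly \<open>n\<close>, so entry
    \<open>n\<close> is read off one stage later.\<close>
  define x where "x n = t (Suc n) ! n" for n
  have mono: "prefix (t i) (t j)" if "i \<le> j" for i j
    using that
  proof (induction rule: dec_induct)
    case (step n)
    from this(3) prefix_order.less_imp_le[OF chain[of n]] show ?case by (rule prefix_order.trans)
  qed simp
  have len: "i \<le> length (t i)" for i
  proof (induction i)
    case (Suc i)
    then show ?case using prefix_length_less[OF chain[of i]] by simp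
  qed simp
  have nth: "t i ! n = t j ! n" if "n < length (t i)" "n < length (t j)" for i j n
  proof (cases "i \<le> j")
    case True
    then obtain u where "t j = t i @ u" using mono unfolding prefix_def by blast
    then show ?thesis using that by (simp add: nth_append)
  next
    case False
    then obtain u where "t i = t j @ u" using mono[of j i] unfolding prefix_def by auto
    then show ?thesis using that by (simp add: nth_append)
  qed
  have eq: "map x [0..<length (t i)] = t i" for i
  proof (rule nth_equalityI)
    fix n assume "n < length (map x [0..<length (t i)])"
    then show "map x [0..<length (t i)] ! n = t i ! n"
      using nth[of n "Suc n" i] len[of "Suc n"] by (simp add: x_def)
  qed simp
  have inT: "map x [0..<n] \<in> T" for n
  proof (rule tree_prefix_closed[OF T t[of n]])
    show "prefix (map x [0..<n]) (t n)"
      by (subst eq[of n, symmetric]) (simp add: prefix_map_upt_iff len)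
  qed
  have "x n < x (Suc n)" for n
  proof -
    have "map x [0..<Suc (Suc n)] \<in> inc_fin_seqs"
      using inT[of "Suc (Suc n)"] T unfolding is_tree_def by blast
    then show ?thesis by (auto simp: inc_fin_seqs_def sorted_wrt_append)
  qed
  then have "x \<in> branches T"
    using inT by (simp add: branches_def inc_inf_seqs_def strict_mono_Suc_iff)
  then show ?thesis using that eq len by blast
qed

subsection \<open>Sacks subtrees from uncountable sets\<close>

text \<open>The tree of condensation nodes of \<open>A\<close>, as in Cantor-Bendixson analysis. Its
  branches lie in the closure of \<open>A\<close>, not necessarily in \<open>A\<close>, so only
  closed properties pass to them.\<close>

definition cond_tree :: "(nat \<Rightarrow> nat) set \<Rightarrow> nat list set" where
  "cond_tree A = {s. uncountable {x \<in> A. map x [0..<length s] = s}}"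

lemma cond_treeE:
  assumes "s \<in> cond_tree A"
  obtains x where "x \<in> A" and "map x [0..<length s] = s"
proof -
  define B where "B = {x \<in> A. map x [0..<length s] = s}"
  have "uncountable B" using assms by (simp add: cond_tree_def B_def)
  then have "B \<noteq> {}" by auto
  then show ?thesis using that by (auto simp: B_def)
qed

lemma cond_tree_closure:
  assumes "x \<in> branches (cond_tree A)"
  shows "\<exists>y\<in>A. \<forall>i<n. y i = x i"
proof -
  have "map x [0..<n] \<in> cond_tree A" using assms by (simp add: branches_def)
  then obtain y where "y \<in> A" "map y [0..<n] = map x [0..<n]" by (rule cond_treeE) simp
  then show ?thesis unfolding map_upt_eq_iff by blast
qed

lemma cond_tree_subset:
  assumes "A \<subseteq> branches S"
  shows "cond_tree A \<subseteq> S"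
proof
  fix s assume "s \<in> cond_tree A"
  then obtain x where "x \<in> A" and s: "map x [0..<length s] = s" by (rule cond_treeE)
  from this(1) have "map x [0..<length s] \<in> S" using assms by (auto simp: branches_def)
  then show "s \<in> S" by (simp only: s)
qed

text \<open>There are only countably many nodes, so discarding every point that passes through a
  node outside \<open>cond_tree A\<close> loses countably many points. Above a node without
  splitting at most one point would survive, although uncountably many pass through it.\<close>

lemma cond_tree_sacks:
  assumes A: "A \<subseteq> inc_inf_seqs" and unc: "uncountable A"
  shows "cond_tree A \<in> sacks_trees"
proof -
  have "[] \<in> cond_tree A" using unc by (simp add: cond_tree_def)
  moreover have "cond_tree A \<subseteq> inc_fin_seqs"
  proof
    fix s assume "s \<in> cond_tree A"
    then obtain x where "x \<in> A" and s: "map x [0..<length s] = s" by (rule cond_treeE)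
    from this(1) have "map x [0..<length s] \<in> inc_fin_seqs" using A map_upt_in_inc_fin_seqs by blast
    then show "s \<in> inc_fin_seqs" by (simp only: s)
  qed
  moreover have "s \<in> cond_tree A" if "t \<in> cond_tree A" "prefix s t" for s t
  proof -
    have "{x \<in> A. map x [0..<length t] = t} \<subseteq> {x \<in> A. map x [0..<length s] = s}"
    proof (intro Collect_mono impI conjI; elim conjE)
      fix x assume "map x [0..<length t] = t"
      then have "prefix s (map x [0..<length t])" using that(2) by (simp only:)
      then show "map x [0..<length s] = s" by (simp only: prefix_map_upt_iff)
    qed
    then show ?thesis using that(1) countable_subset unfolding cond_tree_def by blast
  qed
  ultimately have tree: "is_tree (cond_tree A)" unfolding is_tree_def by blast
  have "\<exists>t\<in>cond_tree A. prefix s t \<and> (\<exists>u\<in>imm_succs (cond_tree A) t. \<exists>v\<in>imm_succs (cond_tree A) t. u \<noteq> v)"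
    if s: "s \<in> cond_tree A" for s
  proof (rule ccontr)
    assume no: "\<not> ?thesis"
    define B where "B = {x \<in> A. map x [0..<length s] = s}"
    define C where "C = {x \<in> B. \<forall>n. map x [0..<n] \<in> cond_tree A}"
    have BC: "B \<subseteq> C \<union> (\<Union>t\<in>- cond_tree A. {x \<in> A. map x [0..<length t] = t})"
    proof
      fix x assume "x \<in> B"
      show "x \<in> C \<union> (\<Union>t\<in>- cond_tree A. {x \<in> A. map x [0..<length t] = t})"
      proof (cases "x \<in> C")
        case False
        then obtain n where "map x [0..<n] \<notin> cond_tree A" using \<open>x \<in> B\<close> by (auto simp: C_def)
        then show ?thesis using \<open>x \<in> B\<close> by (intro UnI2 UN_I[of "map x [0..<n]"]) (auto simp: B_def)
      qed simp
    qed
    have cU: "countable (\<Union>t\<in>- cond_tree A. {x \<in> A. map x [0..<length t] = t})"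
      by (auto simp: cond_tree_def)
    have C_eq: "x = y" if "x \<in> C" "y \<in> C" for x y
    proof (rule ccontr)
      assume "x \<noteq> y"
      then obtain m where m: "x m \<noteq> y m" "\<And>i. i < m \<Longrightarrow> x i = y i"
        using exists_least_iff[of "\<lambda>m. x m \<noteq> y m"] by (auto simp: fun_eq_iff)
      \<comment> \<open>The common part up to the first disagreement is a splitting node above
        \<open>s\<close>.\<close>
      define t where "t = map x [0..<m]"
      have ty: "t = map y [0..<m]" using m(2) by (simp add: t_def map_upt_eq_iff)
      have sx: "map x [0..<length s] = s" "map y [0..<length s] = s" using that by (auto simp: C_def B_def)
      then have "length s \<le> m" using m(1) by (metis map_upt_eq_iff not_le)
      then have "prefix s t" using sx by (simp add: t_def prefix_map_upt_iff)
      moreover have "t \<in> cond_tree A" using that(1) unfolding C_def t_def by blast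
      moreover have "t @ [x m] \<in> imm_succs (cond_tree A) t"
      proof -
        have "map x [0..<Suc m] \<in> cond_tree A" using that(1) unfolding C_def by blast
        then show ?thesis by (simp add: imm_succs_def t_def)
      qed
      moreover have "t @ [y m] \<in> imm_succs (cond_tree A) t"
      proof -
        have "map y [0..<Suc m] \<in> cond_tree A" using that(2) unfolding C_def by blast
        then show ?thesis by (simp add: imm_succs_def ty)
      qed
      moreover have "t @ [x m] \<noteq> t @ [y m]" using m(1) by simp
      ultimately show False using no by blast
    qed
    have "countable C"
    proof (cases "C = {}")
      case False
      then obtain x where "x \<in> C" by blast
      then have "C \<subseteq> {x}" using C_eq by blast
      then show ?thesis by (rule countable_subset) simp
    qed simp
    then have "countable B" by (intro countable_subset[OF BC] countable_Un cU)
    then show False using s by (simp add: B_def cond_tree_def)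
  qed
  then show ?thesis using tree by (simp add: sacks_trees_def)
qed

text \<open>Reading the bits of \<open>\<beta>\<close> at successive splitting nodes embeds the
  Cantor space into the branches. Two successors are kept per splitting node, so each stage has
  finitely many nodes, whence the common bound \<open>M\<close>. The last clause is uniform
  continuity of the inverse, by which bits can be recovered even from limits of points
  \<open>e \<beta>\<close>.\<close>

lemma cantor_scheme:
  assumes S: "S \<in> sacks_trees"
  shows "\<exists>(e :: nat set \<Rightarrow> nat \<Rightarrow> nat) (M :: nat \<Rightarrow> nat).
    (\<forall>\<beta>. e \<beta> \<in> branches S) \<and> (\<forall>\<beta> n. e \<beta> n \<le> M n) \<and>
    (\<forall>m. \<exists>N. \<forall>\<beta> \<gamma>. (\<forall>i<N. e \<beta> i = e \<gamma> i) \<longrightarrow> (\<forall>i<m. i \<in> \<beta> \<longleftrightarrow> i \<in> \<gamma>))"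
proof -
  have tree: "is_tree S" using S by (simp add: sacks_trees_def)
  have "\<exists>r k l. prefix s r \<and> r @ [k] \<in> S \<and> r @ [l] \<in> S \<and> k \<noteq> l" if "s \<in> S" for s
    using S that unfolding sacks_trees_def imm_succs_def by blast
  then obtain r k' l where rkl: "\<And>s. s \<in> S \<Longrightarrow> prefix s (r s) \<and> r s @ [k' s] \<in> S \<and> r s @ [l s] \<in> S \<and> k' s \<noteq> l s"
    by metis
  define k where "k s b = (if b then k' s else l s)" for s and b :: bool
  have rk: "prefix s (r s)" "r s @ [k s b] \<in> S" "k s True \<noteq> k s False" if "s \<in> S" for s b
    using rkl[OF that] by (auto simp: k_def)
  define p where "p \<beta> = rec_nat [] (\<lambda>n s. r s @ [k s (n \<in> \<beta>)])" for \<beta> :: "nat set"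
  have p0: "p \<beta> 0 = []" and pSuc: "p \<beta> (Suc n) = r (p \<beta> n) @ [k (p \<beta> n) (n \<in> \<beta>)]" for \<beta> n
    by (simp_all add: p_def)
  have pS: "p \<beta> n \<in> S" for \<beta> n
    by (induction n) (simp_all add: p0 pSuc Nil_in_tree[OF tree] rk)
  have chain: "strict_prefix (p \<beta> n) (p \<beta> (Suc n))" for \<beta> n
  proof -
    obtain u where "r (p \<beta> n) = p \<beta> n @ u" using rk(1)[OF pS] unfolding prefix_def by blast
    then show ?thesis by (simp add: pSuc strict_prefix_def)
  qed
  have "\<exists>x. x \<in> branches S \<and> (\<forall>i. map x [0..<length (p \<beta> i)] = p \<beta> i) \<and> (\<forall>i. i \<le> length (p \<beta> i))" for \<beta>
    by (rule branch_of_chain[of S "p \<beta>", OF tree pS chain]) blast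
  then obtain e where e: "\<And>\<beta>. e \<beta> \<in> branches S" "\<And>\<beta> i. map (e \<beta>) [0..<length (p \<beta> i)] = p \<beta> i"
      and len: "\<And>\<beta> i. i \<le> length (p \<beta> i)" by metis
  have fin: "finite (range (\<lambda>\<beta>. p \<beta> n))" for n
  proof (induction n)
    case (Suc n)
    have "range (\<lambda>\<beta>. p \<beta> (Suc n)) \<subseteq> (\<lambda>(s, b). r s @ [k s b]) ` (range (\<lambda>\<beta>. p \<beta> n) \<times> UNIV)"
      by (auto simp: pSuc)
    then show ?case by (rule finite_subset) (intro finite_imageI finite_cartesian_product Suc finite)
  qed (simp add: p0)
  define M where "M n = Max (\<Union>s\<in>range (\<lambda>\<beta>. p \<beta> (Suc n)). set s)" for n
  have eM: "e \<beta> n \<le> M n" for \<beta> n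
  proof -
    have "n < length (p \<beta> (Suc n))" using len[of "Suc n" \<beta>] by simp
    then have "e \<beta> n \<in> set (p \<beta> (Suc n))"
      by (subst e(2)[symmetric]) simp
    moreover have "finite (\<Union>s\<in>range (\<lambda>\<beta>. p \<beta> (Suc n)). set s)" using fin by blast
    ultimately show ?thesis unfolding M_def by (intro Max_ge) auto
  qed
  \<comment> \<open>The induction also carries \<open>p \<beta> m = p \<gamma> m\<close>: bit
    \<open>m\<close> can be compared only when both walks stand at the same node.\<close>
  have "\<exists>N. \<forall>\<beta> \<gamma>. (\<forall>i<N. e \<beta> i = e \<gamma> i) \<longrightarrow> (\<forall>i<m. i \<in> \<beta> \<longleftrightarrow> i \<in> \<gamma>) \<and> p \<beta> m = p \<gamma> m" for m
  proof (induction m)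
    case 0 then show ?case by (simp add: p0)
  next
    case (Suc m)
    then obtain N where N: "\<And>\<beta> \<gamma>. (\<forall>i<N. e \<beta> i = e \<gamma> i) \<Longrightarrow> (\<forall>i<m. i \<in> \<beta> \<longleftrightarrow> i \<in> \<gamma>) \<and> p \<beta> m = p \<gamma> m"
      by blast
    define L where "L = Max (length ` range (\<lambda>\<beta>. p \<beta> (Suc m)))"
    have L: "length (p \<beta> (Suc m)) \<le> L" for \<beta>
      unfolding L_def using fin by (intro Max_ge) auto
    show ?case
    proof (intro exI[of _ "max N L"] allI impI)
      fix \<beta> \<gamma> assume eq: "\<forall>i<max N L. e \<beta> i = e \<gamma> i"
      then have 1: "\<forall>i<m. i \<in> \<beta> \<longleftrightarrow> i \<in> \<gamma>" "p \<beta> m = p \<gamma> m" using N by auto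
      define s where "s = p \<beta> m"
      \<comment> \<open>The entry right after the splitting node is the successor selected by bit
        \<open>m\<close>.\<close>
      have last: "e \<delta> (length (r (p \<delta> m))) = k (p \<delta> m) (m \<in> \<delta>)" for \<delta>
      proof -
        have "e \<delta> (length (r (p \<delta> m))) = map (e \<delta>) [0..<length (p \<delta> (Suc m))] ! (length (r (p \<delta> m)))"
          by (simp add: pSuc del: upt_Suc)
        then show ?thesis by (simp only: e(2)) (simp add: pSuc)
      qed
      have "length (r (p \<beta> m)) < L" using L[of \<beta>] by (simp add: pSuc)
      then have "k s (m \<in> \<beta>) = k s (m \<in> \<gamma>)" using last[of \<beta>] last[of \<gamma>] eq 1 by (simp add: s_def)
      then have "m \<in> \<beta> \<longleftrightarrow> m \<in> \<gamma>" using rk(3)[of s] pS by (metis (full_types) s_def)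
      then show "(\<forall>i<Suc m. i \<in> \<beta> \<longleftrightarrow> i \<in> \<gamma>) \<and> p \<beta> (Suc m) = p \<gamma> (Suc m)"
        using 1 by (simp add: pSuc less_Suc_eq)
    qed
  qed
  then have "\<exists>N. \<forall>\<beta> \<gamma>. (\<forall>i<N. e \<beta> i = e \<gamma> i) \<longrightarrow> (\<forall>i<m. i \<in> \<beta> \<longleftrightarrow> i \<in> \<gamma>)" for m
    by meson
  with e(1) eM show ?thesis by (intro exI[of _ e] exI[of _ M] conjI allI)
qed

lemma uncountable_UNIV_nat_set: "uncountable (UNIV :: nat set set)"
proof
  assume "countable (UNIV :: nat set set)"
  then have "range (from_nat_into (UNIV :: nat set set)) = UNIV" by (intro range_from_nat_into) auto
  then show False using Cantors_theorem[of "UNIV :: nat set"] by auto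
qed

subsection \<open>Walking through a Miller tree\<close>

text \<open>A compact set for every \<open>g\<close>, since each coordinate has finitely many
  possible values. The bound on a step depends on the value reached and not on the index, so the
  sizes of jumps matter but not when they occur.\<close>

definition step_bounded :: "(nat \<Rightarrow> nat) \<Rightarrow> (nat \<Rightarrow> nat) set" where
  "step_bounded g = {x \<in> inc_inf_seqs. x 0 \<le> g 0 \<and> (\<forall>n. x (Suc n) \<le> g (x n))}"

text \<open>
  The iterates \<open>(h ^^ i) 0\<close> cut the natural numbers into intervals. A branch visits an interval near its
  left endpoint \<open>c\<close>, up to \<open>w c\<close>, on account of the jump that brought it there; whether it has a further
  value in the interval can be decided freely at a node of infinite splitting, and this is the coded bit.
\<close>

definition gaps_hit :: "(nat \<Rightarrow> nat) \<Rightarrow> (nat \<Rightarrow> nat) \<Rightarrow> (nat \<Rightarrow> nat) \<Rightarrow> nat set" where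
  "gaps_hit w h x = {i. \<exists>n. w ((h ^^ i) 0) < x n \<and> x n < (h ^^ Suc i) 0}"

text \<open>Failure of domination gives an escape at an unknown \<open>n\<close>, but one at an
  iterate of \<open>h\<close> is wanted. If \<open>f\<close> bounded every interval, then for
  \<open>n\<close> in interval \<open>i\<close> monotonicity would give
  \<open>h n \<le> (h ^^ (i + 2)) 0 \<le> f (f n)\<close>; the second application of
  \<open>f\<close> absorbs the mismatch.\<close>

lemma two_step_escape:
  fixes f h :: "nat \<Rightarrow> nat"
  assumes "mono f" "mono h" and h: "\<And>n. n < h n" and n: "f (f n) < h n"
  shows "\<exists>i. f ((h ^^ i) 0) < (h ^^ Suc i) 0"
proof (rule ccontr)
  assume "\<not> ?thesis"
  then have le: "(h ^^ Suc i) 0 \<le> f ((h ^^ i) 0)" for i by (meson not_le)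
  have "i \<le> (h ^^ i) 0" for i
  proof (induction i)
    case (Suc i) then show ?case using h[of "(h ^^ i) 0"] by simp
  qed simp
  from this[of "Suc n"] have ex: "\<exists>i. n < (h ^^ i) 0" by (intro exI[of _ "Suc n"]) linarith
  define j where "j = (LEAST i. n < (h ^^ i) 0)"
  have j: "n < (h ^^ j) 0" unfolding j_def by (rule LeastI_ex[OF ex])
  \<comment> \<open>The iteration starts at 0, which does not exceed \<open>n\<close>, so
    \<open>j\<close> is not 0.\<close>
  then obtain i where i: "j = Suc i" by (cases j) auto
  then have "(h ^^ i) 0 \<le> n" using not_less_Least[of i "\<lambda>i. n < (h ^^ i) 0"] by (simp add: j_def)
  have "h n \<le> h ((h ^^ Suc i) 0)" using j i by (intro monoD[OF \<open>mono h\<close>]) simp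
  also have "\<dots> \<le> f ((h ^^ Suc i) 0)" using le[of "Suc i"] by simp
  also have "\<dots> \<le> f (f ((h ^^ i) 0))" by (intro monoD[OF \<open>mono f\<close>] le)
  also have "\<dots> \<le> f (f n)" by (intro monoD[OF \<open>mono f\<close>] \<open>(h ^^ i) 0 \<le> n\<close>)
  finally show False using n by simp
qed

definition steps_below :: "(nat \<Rightarrow> nat) \<Rightarrow> nat list \<Rightarrow> bool" where
  "steps_below g t \<longleftrightarrow> t \<noteq> [] \<and> t ! 0 \<le> g 0 \<and> (\<forall>n. Suc n < length t \<longrightarrow> t ! Suc n \<le> g (t ! n))"

text \<open>In an increasing list every predecessor of a new entry is at least
  \<open>last t\<close>, so the single bound \<open>g (last t)\<close> covers all new steps.\<close>

lemma steps_below_append: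
  assumes t: "steps_below g t" and sorted: "sorted_wrt (<) (t @ ys)" and g: "mono g"
    and ys: "\<And>y. y \<in> set ys \<Longrightarrow> y \<le> g (last t)"
  shows "steps_below g (t @ ys)"
  unfolding steps_below_def
proof (intro conjI allI impI)
  fix n assume n: "Suc n < length (t @ ys)"
  show "(t @ ys) ! Suc n \<le> g ((t @ ys) ! n)"
  proof (cases "Suc n < length t")
    case True
    then show ?thesis using t by (simp add: steps_below_def nth_append)
  next
    case False
    then have "(t @ ys) ! Suc n = ys ! (Suc n - length t)" by (simp add: nth_append)
    moreover have "Suc n - length t < length ys" using n False by auto
    ultimately have "(t @ ys) ! Suc n \<le> g (last t)" using ys by simp
    also have "last t \<le> (t @ ys) ! n"
    proof -
      have "t \<noteq> []" using t by (simp add: steps_below_def)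
      then have "last t = (t @ ys) ! (length t - 1)" by (simp add: last_conv_nth nth_append)
      moreover have "length t - 1 \<le> n" using False by simp
      ultimately show ?thesis using sorted n
        by (cases "length t - 1 = n") (auto simp: sorted_wrt_iff_nth_less less_imp_le)
    qed
    then have "g (last t) \<le> g ((t @ ys) ! n)" by (rule monoD[OF g])
    finally show ?thesis .
  qed
qed (use t in \<open>auto simp: steps_below_def nth_append\<close>)

text \<open>From an infinitely splitting node one can jump as far as desired and go on to another
  such node; \<open>v\<close> bounds the entries this produces, uniformly over the finitely many
  nodes with small entries. As \<open>v\<close> depends on \<open>T\<close> alone, \<open>w\<close>
  and \<open>h\<close> may be supplied afterwards. The last conclusion records a long jump in each
  interval, which serves to keep the branch out of sets \<open>step_bounded g\<close> with smaller
  \<open>g\<close>.\<close>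

lemma miller_walk:
  assumes T: "T \<in> miller_trees"
  obtains v :: "nat \<Rightarrow> nat" where
    "\<And>w h \<beta>. mono w \<Longrightarrow> (\<And>n. n < w n) \<Longrightarrow> (\<And>n. v n \<le> w n) \<Longrightarrow> mono h \<Longrightarrow>
      (\<And>n. w (Suc (w n)) < h n) \<Longrightarrow>
      \<exists>x\<in>branches T. x \<in> step_bounded (\<lambda>n. w (h n)) \<and> gaps_hit w h x = \<beta> \<and>
        (\<forall>i. \<exists>n. x n \<le> w (Suc (w ((h ^^ i) 0))) \<and> (h ^^ Suc i) 0 \<le> x (Suc n))"
proof -
  have tree: "is_tree T" using T by (simp add: miller_trees_def)
  have sorted: "sorted_wrt (<) t" if "t \<in> T" for t
    using tree that by (auto simp: is_tree_def inc_fin_seqs_def)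
  define Sp where "Sp = {t \<in> T. infinite (imm_succs T t)}"
  have above: "\<exists>t'\<in>Sp. prefix t t'" if "t \<in> T" for t
    using T that by (auto simp: miller_trees_def Sp_def)
  have "\<exists>t'\<in>Sp. \<exists>a\<ge>k. prefix (t @ [a]) t'" if "t \<in> Sp" for t k
  proof -
    have "imm_succs T t \<subseteq> (\<lambda>a. t @ [a]) ` {a. t @ [a] \<in> T}" by (auto simp: imm_succs_def)
    moreover have "infinite (imm_succs T t)" using that by (simp add: Sp_def)
    ultimately have "infinite {a. t @ [a] \<in> T}" by (meson finite_imageI finite_subset)
    then obtain a where "a \<ge> k" "t @ [a] \<in> T" unfolding infinite_nat_iff_unbounded_le by blast
    then show ?thesis using above by blast
  qed
  then have "\<forall>t\<in>Sp. \<forall>k. \<exists>t' a. t' \<in> Sp \<and> k \<le> a \<and> prefix (t @ [a]) t'" by blast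
  then obtain E a where "\<forall>t\<in>Sp. \<forall>k. E t k \<in> Sp \<and> k \<le> a t k \<and> prefix (t @ [a t k]) (E t k)"
    by metis
  then have E: "E t k \<in> Sp" "k \<le> a t k" "prefix (t @ [a t k]) (E t k)" if "t \<in> Sp" for t k
    using that by blast+
  obtain t1 where "t1 \<in> Sp" using above[OF Nil_in_tree[OF tree]] by blast
  \<comment> \<open>\<open>t1\<close> may be empty; one jump makes the starting node
    nonempty.\<close>
  define t0 where "t0 = E t1 0"
  have t0: "t0 \<in> Sp" "t0 \<noteq> []" using E[OF \<open>t1 \<in> Sp\<close>, of 0] by (auto simp: t0_def)
  \<comment> \<open>Nodes are strictly increasing, so finitely many have all entries at most
    \<open>k\<close>.\<close>
  define Q where "Q k = {t \<in> Sp. set t \<subseteq> {..k}}" for k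
  have "finite (Q k)" for k
  proof (rule finite_subset)
    show "Q k \<subseteq> {t. set t \<subseteq> {..k} \<and> distinct t}"
      using sorted by (auto simp: Q_def Sp_def strict_sorted_iff)
    show "finite {t. set t \<subseteq> {..k} \<and> distinct t}" by (rule finite_subset_distinct) simp
  qed
  \<comment> \<open>Including \<open>t0\<close> makes \<open>w 0\<close> a bound for the starting
    node of the walk.\<close>
  define B where "B k = set t0 \<union> (\<Union>t\<in>Q k. set (E t k))" for k
  define v where "v k = Max (B k)" for k
  have v: "z \<le> v k" if "z \<in> B k" for z k
    unfolding v_def using \<open>finite (Q k)\<close> that by (intro Max_ge) (auto simp: B_def)
  show thesis
  proof (rule that[of v])
    fix w h :: "nat \<Rightarrow> nat" and \<beta> :: "nat set"
    assume w: "mono w" "\<And>n. n < w n" "\<And>n. v n \<le> w n" and h: "mono h" "\<And>n. w (Suc (w n)) < h n"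
    define c where "c i = (h ^^ i) 0" for i
    have c0: "c 0 = 0" and cSuc: "c (Suc i) = h (c i)" for i by (simp_all add: c_def)
    have cw: "w (Suc (w (c i))) < c (Suc i)" for i using h(2) by (simp add: cSuc)
    have wc: "w (c i) < c (Suc i)" for i using w(2)[of "Suc (w (c i))"] cw[of i] by linarith
    have "c i \<le> c (Suc i)" for i using w(2)[of "c i"] wc[of i] by linarith
    then have cmono: "c i \<le> c j" if "i \<le> j" for i j by (rule lift_Suc_mono_le) (rule that)
    define g where "g n = w (h n)" for n
    have g: "mono g" using w(1) h(1) by (auto simp: g_def mono_def)
    have gc: "g (c i) = w (c (Suc i))" for i by (simp add: g_def cSuc)
    \<comment> \<open>The lower bound holds because the first new entry is at least \<open>k\<close>
      and the list increases; the upper bound because \<open>t\<close> belongs to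
      \<open>Q k\<close>.\<close>
    have E_ext: "\<exists>ys. E t k = t @ ys \<and> ys \<noteq> [] \<and> set ys \<subseteq> {k..w k}" if "t \<in> Sp" "set t \<subseteq> {..k}" for t k
    proof -
      obtain zs where zs: "E t k = t @ a t k # zs" using E(3)[OF \<open>t \<in> Sp\<close>] by (auto simp: prefix_def)
      have "sorted_wrt (<) (E t k)" using E(1)[OF that(1)] sorted by (auto simp: Sp_def)
      then have "\<forall>z\<in>set zs. a t k < z" by (simp add: zs sorted_wrt_append)
      then have "k \<le> z" if "z \<in> set (a t k # zs)" for z
        using that E(2)[OF \<open>t \<in> Sp\<close>, of k] by fastforce
      moreover have "z \<le> w k" if "z \<in> set (a t k # zs)" for z
      proof -
        have "z \<in> B k" using that \<open>t \<in> Sp\<close> \<open>set t \<subseteq> {..k}\<close> zs by (auto simp: B_def Q_def)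
        then show ?thesis using v w(3) by (meson le_trans)
      qed
      ultimately show ?thesis using zs by (intro exI[of _ "a t k # zs"]) auto
    qed
    \<comment> \<open>Stage \<open>i\<close> records bit \<open>i\<close> by an optional jump just past \<open>w (c i)\<close>, then jumps past \<open>c (Suc i)\<close>.\<close>
    define mid where "mid i t = (if i \<in> \<beta> then E t (Suc (w (c i))) else t)" for i t
    define u where "u = rec_nat t0 (\<lambda>i t. E (mid i t) (c (Suc i)))"
    have u0: "u 0 = t0" and uSuc: "u (Suc i) = E (mid i (u i)) (c (Suc i))" for i by (simp_all add: u_def)
    have mid: "\<exists>ys. mid i t = t @ ys \<and> (ys \<noteq> [] \<longleftrightarrow> i \<in> \<beta>) \<and> set ys \<subseteq> {w (c i)<..w (Suc (w (c i)))}"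
      if "t \<in> Sp" "set t \<subseteq> {..w (c i)}" for i t
    proof (cases "i \<in> \<beta>")
      case True
      have "set t \<subseteq> {..Suc (w (c i))}" using that(2) by auto
      from E_ext[OF that(1) this] show ?thesis
        unfolding atLeastSucAtMost_greaterThanAtMost mid_def using True by simp
    qed (simp add: mid_def)
    have mid_Sp: "mid i t \<in> Sp" if "t \<in> Sp" for i t using that E(1) by (simp add: mid_def)
    \<comment> \<open>This is what \<open>E_ext\<close> requires for the jump to
      \<open>c (Suc i)\<close> that follows the optional one.\<close>
    have mid_set: "set (mid i t) \<subseteq> {..c (Suc i)}" if "t \<in> Sp" "set t \<subseteq> {..w (c i)}" for i t
    proof -
      obtain ys where "mid i t = t @ ys" "set ys \<subseteq> {w (c i)<..w (Suc (w (c i)))}"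
        using mid[OF \<open>t \<in> Sp\<close> \<open>set t \<subseteq> {..w (c i)}\<close>] by blast
      then show ?thesis using that(2) cw[of i] wc[of i] by fastforce
    qed
    \<comment> \<open>The upper bound on the entries admits the next jump. The lower bound on the
      last entry keeps that jump within \<open>g\<close>, since
      \<open>g (c i) = w (c (Suc i))\<close>.\<close>
    have inv: "u i \<in> Sp \<and> set (u i) \<subseteq> {..w (c i)} \<and> c i \<le> last (u i) \<and> steps_below g (u i)" for i
    proof (induction i)
      case 0
      have le: "z \<le> w 0" if "z \<in> set t0" for z
        using v[of z 0] w(3)[of 0] that by (auto simp: B_def)
      have "w 0 \<le> g n" for n unfolding g_def by (intro monoD[OF w(1)]) simp
      then have "z \<le> g n" if "z \<in> set t0" for z n using le that by (meson le_trans)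
      then show ?case using t0 le by (auto simp: u0 c0 steps_below_def)
    next
      case (Suc i)
      define m where "m = mid i (u i)"
      obtain ys where ys: "m = u i @ ys" "set ys \<subseteq> {w (c i)<..w (Suc (w (c i)))}"
        using mid[of "u i" i] Suc by (auto simp: m_def)
      obtain zs where zs: "u (Suc i) = m @ zs" "zs \<noteq> []" "set zs \<subseteq> {c (Suc i)..w (c (Suc i))}"
        using E_ext[OF mid_Sp mid_set, of "u i" i] Suc by (auto simp: m_def uSuc)
      have "u (Suc i) \<in> Sp" using Suc E(1) mid_Sp by (auto simp: uSuc)
      then have s: "sorted_wrt (<) (u (Suc i))" using sorted by (auto simp: Sp_def)
      have m: "steps_below g m"
        unfolding ys(1)
      proof (rule steps_below_append[OF _ _ g])
        show "sorted_wrt (<) (u i @ ys)" using s zs(1) ys(1) by (simp add: sorted_wrt_append)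
        fix y assume "y \<in> set ys"
        then have "y \<le> w (Suc (w (c i)))" using ys(2) by auto
        also have "\<dots> \<le> g (c i)" using cw[of i] w(2)[of "c (Suc i)"] by (simp add: gc)
        also have "\<dots> \<le> g (last (u i))" using Suc by (intro monoD[OF g]) simp
        finally show "y \<le> g (last (u i))" .
      qed (use Suc in simp)
      have "c i \<le> last m"
      proof (cases "ys = []")
        case False
        then have "last m \<in> set ys" using ys(1) by simp
        then have "w (c i) < last m" using ys(2) by auto
        then show ?thesis using w(2)[of "c i"] by linarith
      qed (use ys Suc in simp)
      have "steps_below g (u (Suc i))"
        unfolding zs(1)
      proof (rule steps_below_append[OF m _ g])
        show "sorted_wrt (<) (m @ zs)" using s zs(1) by simp
        fix z assume "z \<in> set zs"
        then have "z \<le> g (c i)" using zs(3) by (auto simp: gc)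
        also have "\<dots> \<le> g (last m)" using \<open>c i \<le> last m\<close> by (intro monoD[OF g])
        finally show "z \<le> g (last m)" .
      qed
      moreover have "last (u (Suc i)) \<in> set zs" using zs by simp
      then have "c (Suc i) \<le> last (u (Suc i))" using zs(3) by auto
      moreover have "set (u (Suc i)) \<subseteq> {..w (c (Suc i))}"
      proof -
        have "set m \<subseteq> {..c (Suc i)}" unfolding m_def using Suc by (intro mid_set) auto
        then show ?thesis using zs w(2)[of "c (Suc i)"] by fastforce
      qed
      ultimately show ?case using \<open>u (Suc i) \<in> Sp\<close> by blast
    qed
    have next_u: "\<exists>ys zs. mid i (u i) = u i @ ys \<and> u (Suc i) = u i @ ys @ zs \<and> (ys \<noteq> [] \<longleftrightarrow> i \<in> \<beta>) \<and> zs \<noteq> [] \<and>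
        set ys \<subseteq> {w (c i)<..w (Suc (w (c i)))} \<and> set zs \<subseteq> {c (Suc i)..w (c (Suc i))}" for i
    proof -
      obtain ys where ys: "mid i (u i) = u i @ ys" "ys \<noteq> [] \<longleftrightarrow> i \<in> \<beta>" "set ys \<subseteq> {w (c i)<..w (Suc (w (c i)))}"
        using mid[of "u i" i] inv[of i] by auto
      obtain zs where "u (Suc i) = mid i (u i) @ zs" "zs \<noteq> []" "set zs \<subseteq> {c (Suc i)..w (c (Suc i))}"
        using E_ext[OF mid_Sp mid_set, of "u i" i] inv[of i] by (auto simp: uSuc)
      then show ?thesis using ys by (intro exI[of _ ys] exI[of _ zs]) simp
    qed
    have uT: "u i \<in> T" for i using inv[of i] by (simp add: Sp_def)
    have "strict_prefix (u i) (u (Suc i))" for i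
    proof -
      obtain ys zs where "u (Suc i) = u i @ ys @ zs" "zs \<noteq> []" using next_u[of i] by blast
      then show ?thesis by (simp add: strict_prefix_def)
    qed
    then obtain x where x: "x \<in> branches T" and xu: "\<And>i. map x [0..<length (u i)] = u i"
        and len: "\<And>i. i \<le> length (u i)"
      using branch_of_chain[of T u, OF tree uT] by blast
    have nth: "u i ! n = x n" if "n < length (u i)" for i n
    proof -
      have "u i ! n = map x [0..<length (u i)] ! n" by (simp only: xu)
      then show ?thesis using that by simp
    qed
    have in_u: "x n \<in> set (u (Suc n))" for n
      using nth[of n "Suc n"] len[of "Suc n"] by (metis Suc_le_eq nth_mem)
    have "x \<in> inc_inf_seqs" using x by (simp add: branches_def)
    moreover have "x 0 \<le> g 0" using inv[of 1] nth[of 0 1] by (auto simp: steps_below_def)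
    moreover have "x (Suc n) \<le> g (x n)" for n
    proof -
      have "Suc n < length (u (Suc (Suc n)))" using len[of "Suc (Suc n)"] by simp
      moreover from this have "u (Suc (Suc n)) ! Suc n \<le> g (u (Suc (Suc n)) ! n)"
        using inv[of "Suc (Suc n)"] unfolding steps_below_def by blast
      ultimately show ?thesis by (simp add: nth)
    qed
    ultimately have "x \<in> step_bounded g" by (simp add: step_bounded_def)
    moreover have "gaps_hit w h x = \<beta>"
    proof (intro equalityI subsetI)
      fix i assume "i \<in> gaps_hit w h x"
      then obtain n where n: "w (c i) < x n" "x n < c (Suc i)" by (auto simp: gaps_hit_def c_def)
      show "i \<in> \<beta>"
      proof (rule ccontr)
        assume i: "i \<notin> \<beta>"
        \<comment> \<open>Only the optional block of stage \<open>i\<close> can reach this range: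
          the start and all earlier blocks stay at or below \<open>w (c i)\<close>, all later ones
          at or above \<open>c (Suc i)\<close>.\<close>
        have "z \<notin> set (u j)" if z: "w (c i) < z" "z < c (Suc i)" for z j
        proof (induction j)
          case 0
          have "w (c 0) \<le> w (c i)" by (intro monoD[OF w(1)] cmono) simp
          then show ?case using inv[of 0] z by fastforce
        next
          case (Suc j)
          obtain ys zs where yz: "u (Suc j) = u j @ ys @ zs" "ys \<noteq> [] \<longleftrightarrow> j \<in> \<beta>"
            "set ys \<subseteq> {w (c j)<..w (Suc (w (c j)))}" "set zs \<subseteq> {c (Suc j)..w (c (Suc j))}"
            using next_u[of j] by blast
          have "z \<notin> set ys"
          proof
            assume "z \<in> set ys"
            then have "j \<noteq> i" using i yz(2) by auto
            have 1: "w (c j) < z" "z < c (Suc j)" using \<open>z \<in> set ys\<close> yz(3) cw[of j] by auto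
            show False
            proof (cases "j < i")
              case True
              then show ?thesis using 1 z cmono[of "Suc j" i] w(2)[of "c i"] by simp
            next
              case False
              then show ?thesis using 1 z \<open>j \<noteq> i\<close> cmono[of "Suc i" j] w(2)[of "c j"] by simp
            qed
          qed
          moreover have "z \<notin> set zs"
          proof
            assume "z \<in> set zs"
            then have 1: "c (Suc j) \<le> z" "z \<le> w (c (Suc j))" using yz(4) by auto
            show False
            proof (cases "j < i")
              case True
              then have "w (c (Suc j)) \<le> w (c i)" by (intro monoD[OF w(1)] cmono) simp
              then show ?thesis using 1 z by simp
            next
              case False
              then show ?thesis using 1 z cmono[of "Suc i" "Suc j"] by simp
            qed
          qed
          ultimately show ?case using Suc yz(1) by simp
        qed
        from this[OF n] show False using in_u by blast
      qed
    next
      fix i assume "i \<in> \<beta>"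
      then obtain ys zs where yz: "u (Suc i) = u i @ ys @ zs" "ys \<noteq> []" "set ys \<subseteq> {w (c i)<..w (Suc (w (c i)))}"
        using next_u[of i] by blast
      let ?n = "length (u i)"
      have "x ?n = hd ys" using nth[of ?n "Suc i"] yz by (simp add: nth_append hd_conv_nth)
      then have "x ?n \<in> set ys" using yz(2) by simp
      then have "w (c i) < x ?n" "x ?n < c (Suc i)" using yz(3) cw[of i] by auto
      then show "i \<in> gaps_hit w h x" by (auto simp: gaps_hit_def c_def)
    qed
    moreover have "\<exists>n. x n \<le> w (Suc (w (c i))) \<and> c (Suc i) \<le> x (Suc n)" for i
    proof -
      obtain ys zs where yz: "u (Suc i) = u i @ ys @ zs" "zs \<noteq> []" "set ys \<subseteq> {w (c i)<..w (Suc (w (c i)))}"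
          "set zs \<subseteq> {c (Suc i)..w (c (Suc i))}"
        using next_u[of i] by blast
      define m where "m = u i @ ys"
      have "u i \<noteq> []" using inv[of i] by (simp add: steps_below_def)
      \<comment> \<open>\<open>n\<close> is the last position of \<open>m\<close>, just before the
        long jump into \<open>zs\<close>.\<close>
      then obtain n where n: "length m = Suc n" by (cases "length m") (auto simp: m_def)
      have um: "u (Suc i) = m @ zs" by (simp add: m_def yz)
      have "x n = m ! n" using nth[of n "Suc i"] n by (simp add: um nth_append)
      then have "x n \<in> set m" using n by simp
      moreover have "w (c i) \<le> w (Suc (w (c i)))" using w(2)[of "c i"] by (intro monoD[OF w(1)]) simp
      ultimately have "x n \<le> w (Suc (w (c i)))" using yz(3) inv[of i] by (fastforce simp: m_def)
      moreover have "x (Suc n) = zs ! 0" using nth[of "Suc n" "Suc i"] n yz(2) by (simp add: um nth_append)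
      then have "x (Suc n) \<in> set zs" using yz(2) by simp
      then have "c (Suc i) \<le> x (Suc n)" using yz(4) by auto
      ultimately show ?thesis by blast
    qed
    ultimately show "\<exists>x\<in>branches T. x \<in> step_bounded (\<lambda>n. w (h n)) \<and> gaps_hit w h x = \<beta> \<and>
        (\<forall>i. \<exists>n. x n \<le> w (Suc (w ((h ^^ i) 0))) \<and> (h ^^ Suc i) 0 \<le> x (Suc n))"
      using x unfolding c_def g_def by blast
  qed
qed

subsection \<open>A hierarchy of compact sets\<close>

definition dominating :: "(nat \<Rightarrow> nat) set \<Rightarrow> bool" where
  "dominating \<Phi> \<longleftrightarrow> (\<forall>f. \<exists>g\<in>\<Phi>. \<forall>n. f n \<le> g n)"

text \<open>Turns an arbitrary function into a monotone one above the identity that exceeds all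
  values of \<open>f\<close> up to \<open>n\<close>.\<close>

definition majorant :: "(nat \<Rightarrow> nat) \<Rightarrow> nat \<Rightarrow> nat" where
  "majorant f n = Suc (n + (\<Sum>i\<le>n. f i))"

lemma mono_majorant: "mono (majorant f)"
  by (intro monoI) (auto simp: majorant_def intro!: add_mono sum_mono2)

lemma less_majorant: "n < majorant f n"
  by (simp add: majorant_def)

lemma majorant_ge: "i \<le> n \<Longrightarrow> f i < majorant f n"
proof -
  assume "i \<le> n"
  then have "f i \<le> (\<Sum>i\<le>n. f i)" by (intro member_le_sum) auto
  then show ?thesis by (simp add: majorant_def)
qed

lemma minimal_dominating:
  obtains \<Phi> where "dominating \<Phi>" and "\<And>\<Psi>. dominating \<Psi> \<Longrightarrow> |\<Phi>| \<le>o |\<Psi>|"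
proof -
  have "dominating UNIV" by (auto simp: dominating_def)
  then have "card_of ` Collect dominating \<noteq> {}" by blast
  then have "\<exists>r \<in> card_of ` Collect dominating. \<forall>r' \<in> card_of ` Collect dominating. r \<le>o r'"
    by (rule exists_minim_Card_order) (auto simp: card_of_Card_order)
  then show ?thesis using that by blast
qed

text \<open>\<open>h\<close> is built by recursion along a well-order of \<open>\<Phi>\<close> of
  its cardinal type. At stage \<open>\<xi>\<close> fewer than \<open>|\<Phi>|\<close> functions must
  be escaped, and by minimality they do not dominate. The last clause says that some long jump at
  level \<open>\<xi>\<close> exceeds the step bound of the earlier level
  \<open>\<zeta>\<close>.\<close>

lemma escaping_family:
  obtains \<Phi> :: "(nat \<Rightarrow> nat) set" and R and h :: "(nat \<Rightarrow> nat) \<Rightarrow> nat \<Rightarrow> nat"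
  where "dominating \<Phi>" and "wf R"
    and "\<And>\<xi> \<zeta>. \<xi> \<in> \<Phi> \<Longrightarrow> \<zeta> \<in> \<Phi> \<Longrightarrow> \<xi> \<noteq> \<zeta> \<Longrightarrow> (\<xi>, \<zeta>) \<in> R \<or> (\<zeta>, \<xi>) \<in> R"
    and "R \<subseteq> \<Phi> \<times> \<Phi>"
    and "\<And>\<xi>. \<xi> \<in> \<Phi> \<Longrightarrow> mono (h \<xi>)"
    and "\<And>\<xi> n. \<xi> \<in> \<Phi> \<Longrightarrow> majorant \<xi> (Suc (majorant \<xi> n)) < h \<xi> n"
    and "\<And>\<xi> \<zeta>. (\<zeta>, \<xi>) \<in> R \<Longrightarrow>
      \<exists>i. majorant \<zeta> (h \<zeta> (majorant \<xi> (Suc (majorant \<xi> ((h \<xi> ^^ i) 0))))) < (h \<xi> ^^ Suc i) 0"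
proof -
  obtain \<Phi> :: "(nat \<Rightarrow> nat) set" where dom: "dominating \<Phi>"
      and least: "\<And>\<Psi>. dominating \<Psi> \<Longrightarrow> |\<Phi>| \<le>o |\<Psi>|"
    using minimal_dominating by blast
  define R where "R = |\<Phi>| - Id"
  have wo: "well_order_on \<Phi> |\<Phi>|" by (rule card_of_well_order_on)
  have wfR: "wf R" using wo by (simp add: R_def well_order_on_def)
  have lin: "linear_order_on \<Phi> |\<Phi>|" using wo by (simp add: well_order_on_def)
  have total: "(\<xi>, \<zeta>) \<in> R \<or> (\<zeta>, \<xi>) \<in> R" if "\<xi> \<in> \<Phi>" "\<zeta> \<in> \<Phi>" "\<xi> \<noteq> \<zeta>" for \<xi> \<zeta>
    using lin that by (auto simp: R_def linear_order_on_def total_on_def)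
  have RF: "R \<subseteq> \<Phi> \<times> \<Phi>"
  proof
    fix p assume "p \<in> R"
    then obtain \<zeta> \<xi> where "p = (\<zeta>, \<xi>)" "(\<zeta>, \<xi>) \<in> |\<Phi>|" by (cases p) (auto simp: R_def)
    then show "p \<in> \<Phi> \<times> \<Phi>" using FieldI1[of \<zeta> \<xi> "|\<Phi>|"] FieldI2[of \<zeta> \<xi> "|\<Phi>|"] by (simp add: Field_card_of)
  qed
  \<comment> \<open>\<open>V \<xi> n\<close> bounds the position before the long jump in the
    interval starting at \<open>n\<close>; \<open>G\<close> is the farthest that level
    \<open>\<zeta>\<close> may step from there.\<close>
  define V where "V \<xi> n = majorant \<xi> (Suc (majorant \<xi> n))" for \<xi> n
  define G where "G \<zeta> k \<xi> n = majorant \<zeta> (k (V \<xi> n))" for \<zeta> \<xi> :: "nat \<Rightarrow> nat" and k n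
  \<comment> \<open>\<open>G\<close> is iterated twice to match the hypothesis of
    \<open>two_step_escape\<close>.\<close>
  define P where "P h \<xi> k \<longleftrightarrow> (\<xi> \<in> \<Phi> \<longrightarrow> mono k \<and> (\<forall>n. V \<xi> n < k n) \<and>
      (\<forall>\<zeta>. (\<zeta>, \<xi>) \<in> R \<longrightarrow> (\<exists>n. G \<zeta> (h \<zeta>) \<xi> (G \<zeta> (h \<zeta>) \<xi> n) < k n)))" for h \<xi> k
  \<comment> \<open>The condition at \<open>\<xi>\<close> consults \<open>h\<close> only at
    \<open>R\<close>-predecessors, so well-founded recursion with choice applies.\<close>
  have "\<exists>h. \<forall>\<xi>. P h \<xi> (h \<xi>)"
  proof (rule dependent_wf_choice[OF wfR])
    fix f g :: "(nat \<Rightarrow> nat) \<Rightarrow> nat \<Rightarrow> nat" and \<xi> k assume "\<And>\<zeta>. (\<zeta>, \<xi>) \<in> R \<Longrightarrow> f \<zeta> = g \<zeta>"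
    then show "P f \<xi> k = P g \<xi> k" by (simp add: P_def cong: all_cong imp_cong)
  next
    fix \<xi> and h :: "(nat \<Rightarrow> nat) \<Rightarrow> nat \<Rightarrow> nat"
    show "\<exists>k. P h \<xi> k"
    proof (cases "\<xi> \<in> \<Phi>")
      case True
      define \<Psi> where "\<Psi> = (\<lambda>\<zeta> n. G \<zeta> (h \<zeta>) \<xi> (G \<zeta> (h \<zeta>) \<xi> n)) ` underS |\<Phi>| \<xi>"
      have "|\<Psi>| \<le>o |underS |\<Phi>| \<xi>|" unfolding \<Psi>_def by (rule card_of_image)
      moreover have "|underS |\<Phi>| \<xi>| <o |\<Phi>|"
        using True by (intro card_of_underS card_of_Card_order) (simp add: Field_card_of)
      ultimately have "|\<Psi>| <o |\<Phi>|" by (rule ordLeq_ordLess_trans)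
      then have "\<not> dominating \<Psi>" using least not_ordLess_ordLeq by blast
      then obtain e where e: "\<And>\<psi>. \<psi> \<in> \<Psi> \<Longrightarrow> \<exists>n. \<psi> n < e n"
        unfolding dominating_def by (meson not_le)
      \<comment> \<open>Enlarging \<open>e\<close> preserves the escape; the majorant adds
        monotonicity, the summand the lower bound \<open>V\<close>.\<close>
      define k where "k = majorant (\<lambda>n. e n + V \<xi> n)"
      have k: "e n + V \<xi> n < k n" for n
        unfolding k_def using majorant_ge[of n n "\<lambda>n. e n + V \<xi> n"] by simp
      have "\<exists>n. G \<zeta> (h \<zeta>) \<xi> (G \<zeta> (h \<zeta>) \<xi> n) < k n" if "(\<zeta>, \<xi>) \<in> R" for \<zeta>
      proof -
        have "(\<lambda>n. G \<zeta> (h \<zeta>) \<xi> (G \<zeta> (h \<zeta>) \<xi> n)) \<in> \<Psi>"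
          using that by (auto simp: \<Psi>_def underS_def R_def)
        from e[OF this] obtain n where "G \<zeta> (h \<zeta>) \<xi> (G \<zeta> (h \<zeta>) \<xi> n) < e n" by blast
        then show ?thesis using k[of n] by (intro exI[of _ n]) linarith
      qed
      moreover have "V \<xi> n < k n" for n using k[of n] by linarith
      ultimately show ?thesis using mono_majorant unfolding P_def k_def by blast
    qed (simp add: P_def)
  qed
  then obtain h where h: "\<And>\<xi>. P h \<xi> (h \<xi>)" by blast
  have monoh: "mono (h \<xi>)" and Vh: "V \<xi> n < h \<xi> n" if "\<xi> \<in> \<Phi>" for \<xi> n
    using h[of \<xi>] that unfolding P_def by blast+
  show ?thesis
  proof (rule that[OF dom wfR total RF monoh])
    fix \<xi> \<zeta> assume R: "(\<zeta>, \<xi>) \<in> R"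
    then have \<Phi>: "\<xi> \<in> \<Phi>" "\<zeta> \<in> \<Phi>" using RF by auto
    obtain n where n: "G \<zeta> (h \<zeta>) \<xi> (G \<zeta> (h \<zeta>) \<xi> n) < h \<xi> n"
      using h[of \<xi>] \<Phi> R unfolding P_def by blast
    have "\<exists>i. G \<zeta> (h \<zeta>) \<xi> ((h \<xi> ^^ i) 0) < (h \<xi> ^^ Suc i) 0"
    proof (rule two_step_escape[of "G \<zeta> (h \<zeta>) \<xi>" "h \<xi>" n])
      show "mono (G \<zeta> (h \<zeta>) \<xi>)"
        unfolding G_def V_def using mono_majorant monoh[OF \<Phi>(2)] by (simp add: mono_def)
      show "mono (h \<xi>)" by (rule monoh[OF \<Phi>(1)])
      show "G \<zeta> (h \<zeta>) \<xi> (G \<zeta> (h \<zeta>) \<xi> n) < h \<xi> n" by (rule n)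
      show "m < h \<xi> m" for m
      proof -
        have "m < majorant \<xi> m" "majorant \<xi> m < majorant \<xi> (Suc (majorant \<xi> m))"
          using less_majorant[of m \<xi>] less_majorant[of "Suc (majorant \<xi> m)" \<xi>] by linarith+
        then show ?thesis using Vh[OF \<Phi>(1), of m] unfolding V_def by linarith
      qed
    qed
    then show "\<exists>i. majorant \<zeta> (h \<zeta> (majorant \<xi> (Suc (majorant \<xi> ((h \<xi> ^^ i) 0))))) < (h \<xi> ^^ Suc i) 0"
      unfolding G_def V_def .
  qed (use Vh in \<open>simp_all add: V_def\<close>)
qed

lemma step_bounded_closed:
  assumes x: "x \<in> inc_inf_seqs" and y: "\<And>n. \<exists>y\<in>step_bounded g. \<forall>i<n. y i = x i"
  shows "x \<in> step_bounded g"
proof -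
  have "x 0 \<le> g 0" using y[of 1] by (auto simp: step_bounded_def)
  moreover have "x (Suc n) \<le> g (x n)" for n
  proof -
    obtain y where "y \<in> step_bounded g" "\<forall>i<Suc (Suc n). y i = x i" using y by blast
    moreover from this have "y n = x n" "y (Suc n) = x (Suc n)" by simp_all
    ultimately show ?thesis unfolding step_bounded_def by (metis (mono_tags, lifting) mem_Collect_eq)
  qed
  ultimately show ?thesis using x by (simp add: step_bounded_def)
qed

text \<open>As \<open>n \<le> x n\<close> for increasing \<open>x\<close>, values below the right
  endpoint of interval \<open>i\<close> occur at indices below that endpoint, so finitely many
  coordinates decide bit \<open>i\<close>.\<close>

lemma gaps_hit_continuous:
  "\<exists>N. \<forall>x\<in>inc_inf_seqs. \<forall>y\<in>inc_inf_seqs. (\<forall>k<N. x k = y k) \<longrightarrow> (i \<in> gaps_hit w h x \<longleftrightarrow> i \<in> gaps_hit w h y)"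
proof -
  let ?N = "(h ^^ Suc i) 0"
  have "i \<in> gaps_hit w h y"
    if "x \<in> inc_inf_seqs" "\<forall>k<?N. x k = y k" "i \<in> gaps_hit w h x" for x y
  proof -
    obtain n where n: "w ((h ^^ i) 0) < x n" "x n < ?N" using \<open>i \<in> gaps_hit w h x\<close> by (auto simp: gaps_hit_def)
    have "n < ?N" using n(2) inc_inf_seqs_ge[OF that(1), of n] by linarith
    then have "x n = y n" using that(2) by blast
    then show ?thesis using n unfolding gaps_hit_def by auto
  qed
  then show ?thesis by (intro exI[of _ ?N]) (metis (no_types))
qed

text \<open>The interface between the hierarchy and the thin trees. The assumptions
  \<open>bounded\<close>, \<open>closed\<close> and \<open>continuous\<close> serve to shrink Sacks
  trees, \<open>miller_rich\<close> to find branches of Miller trees; the injections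
  \<open>X \<eta>\<close> on \<open>nat set\<close> express continuum many branches with code
  \<open>\<eta>\<close>.\<close>

locale stratification =
  fixes \<Phi> :: "'i set" and R :: "'i rel" and C :: "'i \<Rightarrow> (nat \<Rightarrow> nat) set"
    and F :: "'i \<Rightarrow> (nat \<Rightarrow> nat) \<Rightarrow> nat set"
  assumes wf: "wf R" and subset: "R \<subseteq> \<Phi> \<times> \<Phi>"
    and total: "\<And>\<xi> \<zeta>. \<xi> \<in> \<Phi> \<Longrightarrow> \<zeta> \<in> \<Phi> \<Longrightarrow> \<xi> \<noteq> \<zeta> \<Longrightarrow> (\<xi>, \<zeta>) \<in> R \<or> (\<zeta>, \<xi>) \<in> R"
    and bounded: "\<And>M. \<exists>\<xi>\<in>\<Phi>. {x \<in> inc_inf_seqs. \<forall>n. x n \<le> M n} \<subseteq> C \<xi>"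
    and closed: "\<And>\<xi> x. x \<in> inc_inf_seqs \<Longrightarrow> (\<And>n. \<exists>y\<in>C \<xi>. \<forall>i<n. y i = x i) \<Longrightarrow> x \<in> C \<xi>"
    and continuous: "\<And>\<xi> i. \<exists>N. \<forall>x\<in>inc_inf_seqs. \<forall>y\<in>inc_inf_seqs. (\<forall>k<N. x k = y k) \<longrightarrow> (i \<in> F \<xi> x \<longleftrightarrow> i \<in> F \<xi> y)"
    and miller_rich: "\<And>T. T \<in> miller_trees \<Longrightarrow> \<exists>\<xi>\<in>\<Phi>. \<exists>X. \<forall>\<eta>. inj (X \<eta>) \<and>
      (\<forall>\<rho> :: nat set. X \<eta> \<rho> \<in> branches T \<inter> C \<xi> \<and> F \<xi> (X \<eta> \<rho>) = \<eta> \<and> (\<forall>\<zeta>. (\<zeta>, \<xi>) \<in> R \<longrightarrow> X \<eta> \<rho> \<notin> C \<zeta>))"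

lemma stratification_exists:
  "\<exists>(\<Phi> :: (nat \<Rightarrow> nat) set) R C F. stratification \<Phi> R C F"
proof -
  obtain \<Phi> R h where dom: "dominating \<Phi>" and R: "wf R"
      "\<And>\<xi> \<zeta>. \<xi> \<in> \<Phi> \<Longrightarrow> \<zeta> \<in> \<Phi> \<Longrightarrow> \<xi> \<noteq> \<zeta> \<Longrightarrow> (\<xi>, \<zeta>) \<in> R \<or> (\<zeta>, \<xi>) \<in> R"
      "R \<subseteq> \<Phi> \<times> \<Phi>"
    and h: "\<And>\<xi>. \<xi> \<in> \<Phi> \<Longrightarrow> mono (h \<xi>)" "\<And>\<xi> n. \<xi> \<in> \<Phi> \<Longrightarrow> majorant \<xi> (Suc (majorant \<xi> n)) < h \<xi> n"
    and esc: "\<And>\<xi> \<zeta>. (\<zeta>, \<xi>) \<in> R \<Longrightarrow>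
      \<exists>i. majorant \<zeta> (h \<zeta> (majorant \<xi> (Suc (majorant \<xi> ((h \<xi> ^^ i) 0))))) < (h \<xi> ^^ Suc i) 0"
    using escaping_family by blast
  define C where "C \<xi> = step_bounded (\<lambda>n. majorant \<xi> (h \<xi> n))" for \<xi>
  define F where "F \<xi> x = {i. 2 * i \<in> gaps_hit (majorant \<xi>) (h \<xi>) x}" for \<xi> x
  have gmono: "mono (\<lambda>n. majorant \<xi> (h \<xi> n))" if "\<xi> \<in> \<Phi>" for \<xi>
    using h(1)[OF that] mono_majorant by (simp add: mono_def)
  have "stratification \<Phi> R C F"
  proof
    show "wf R" "R \<subseteq> \<Phi> \<times> \<Phi>" by (fact R)+
    show "(\<xi>, \<zeta>) \<in> R \<or> (\<zeta>, \<xi>) \<in> R" if "\<xi> \<in> \<Phi>" "\<zeta> \<in> \<Phi>" "\<xi> \<noteq> \<zeta>" for \<xi> \<zeta> using that by (rule R(2))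
  next
    fix M :: "nat \<Rightarrow> nat"
    \<comment> \<open>The step bound is evaluated at the value \<open>x n\<close>, which is at least
      \<open>n\<close>, and must cover \<open>M (Suc n)\<close>; hence the shift by one.\<close>
    obtain \<xi> where \<xi>: "\<xi> \<in> \<Phi>" "\<And>n. majorant M (Suc n) \<le> \<xi> n"
      using dom unfolding dominating_def by meson
    have "M i < majorant \<xi> (h \<xi> n)" if "i \<le> Suc n" for i n
    proof -
      have "M i < majorant M (Suc n)" by (rule majorant_ge[OF that])
      also have "\<dots> \<le> \<xi> n" by (rule \<xi>)
      also have "\<dots> < majorant \<xi> n" by (rule majorant_ge) simp
      also have "\<dots> \<le> majorant \<xi> (h \<xi> n)"
      proof (rule monoD[OF mono_majorant])
        show "n \<le> h \<xi> n"
          using h(2)[OF \<xi>(1), of n] less_majorant[of n \<xi>] less_majorant[of "Suc (majorant \<xi> n)" \<xi>] by linarith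
      qed
      finally show ?thesis .
    qed
    moreover have "x (Suc n) \<le> M (Suc n) \<and> n \<le> x n" if "x \<in> inc_inf_seqs" "\<forall>n. x n \<le> M n" for x n
      using that inc_inf_seqs_ge by blast
    ultimately have "x \<in> C \<xi>" if "x \<in> inc_inf_seqs" "\<forall>n. x n \<le> M n" for x
      unfolding C_def step_bounded_def using that
      by (smt (verit, best) Suc_le_mono le0 le_trans less_imp_le mem_Collect_eq)
    then show "\<exists>\<xi>\<in>\<Phi>. {x \<in> inc_inf_seqs. \<forall>n. x n \<le> M n} \<subseteq> C \<xi>" using \<xi>(1) by blast
  next
    fix \<xi> x assume "x \<in> inc_inf_seqs" "\<And>n. \<exists>y\<in>C \<xi>. \<forall>i<n. y i = x i"
    then show "x \<in> C \<xi>" unfolding C_def by (rule step_bounded_closed)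
  next
    fix \<xi> i
    show "\<exists>N. \<forall>x\<in>inc_inf_seqs. \<forall>y\<in>inc_inf_seqs. (\<forall>k<N. x k = y k) \<longrightarrow> (i \<in> F \<xi> x \<longleftrightarrow> i \<in> F \<xi> y)"
      unfolding F_def mem_Collect_eq by (rule gaps_hit_continuous)
  next
    fix T assume "T \<in> miller_trees"
    then obtain v where v: "\<And>w h \<beta>. mono w \<Longrightarrow> (\<And>n. n < w n) \<Longrightarrow> (\<And>n. v n \<le> w n) \<Longrightarrow> mono h \<Longrightarrow>
      (\<And>n. w (Suc (w n)) < h n) \<Longrightarrow>
      \<exists>x\<in>branches T. x \<in> step_bounded (\<lambda>n. w (h n)) \<and> gaps_hit w h x = \<beta> \<and>
        (\<forall>i. \<exists>n. x n \<le> w (Suc (w ((h ^^ i) 0))) \<and> (h ^^ Suc i) 0 \<le> x (Suc n))"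
      using miller_walk by blast
    \<comment> \<open>The level at which \<open>T\<close> is treated: any \<open>\<xi>\<close> above
      the growth of \<open>T\<close>.\<close>
    obtain \<xi> where \<xi>: "\<xi> \<in> \<Phi>" "\<And>n. v n \<le> \<xi> n" using dom unfolding dominating_def by blast
    have "v n \<le> majorant \<xi> n" for n
      using \<xi>(2)[of n] majorant_ge[of n n \<xi>] by simp
    note walk = v[OF mono_majorant less_majorant this h[OF \<xi>(1)]]
    \<comment> \<open>Even bits carry the code; odd bits supply continuum many branches with the same code.\<close>
    define \<beta> where "\<beta> \<eta> \<rho> = {i. if even i then i div 2 \<in> \<eta> else i div 2 \<in> \<rho>}" for \<eta> \<rho> :: "nat set"
    have \<beta>: "2 * i \<in> \<beta> \<eta> \<rho> \<longleftrightarrow> i \<in> \<eta>" "Suc (2 * i) \<in> \<beta> \<eta> \<rho> \<longleftrightarrow> i \<in> \<rho>" for i \<eta> \<rho>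
      by (simp_all add: \<beta>_def)
    have "\<forall>\<eta> \<rho>. \<exists>x. x \<in> branches T \<and> x \<in> C \<xi> \<and> gaps_hit (majorant \<xi>) (h \<xi>) x = \<beta> \<eta> \<rho> \<and>
        (\<forall>i. \<exists>n. x n \<le> majorant \<xi> (Suc (majorant \<xi> ((h \<xi> ^^ i) 0))) \<and> (h \<xi> ^^ Suc i) 0 \<le> x (Suc n))"
    proof (intro allI)
      fix \<eta> \<rho>
      show "\<exists>x. x \<in> branches T \<and> x \<in> C \<xi> \<and> gaps_hit (majorant \<xi>) (h \<xi>) x = \<beta> \<eta> \<rho> \<and>
        (\<forall>i. \<exists>n. x n \<le> majorant \<xi> (Suc (majorant \<xi> ((h \<xi> ^^ i) 0))) \<and> (h \<xi> ^^ Suc i) 0 \<le> x (Suc n))"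
        using walk[of "\<beta> \<eta> \<rho>"] unfolding C_def by blast
    qed
    then obtain X where X: "\<And>\<eta> \<rho>. X \<eta> \<rho> \<in> branches T" "\<And>\<eta> \<rho>. X \<eta> \<rho> \<in> C \<xi>"
        "\<And>\<eta> \<rho>. gaps_hit (majorant \<xi>) (h \<xi>) (X \<eta> \<rho>) = \<beta> \<eta> \<rho>"
        "\<And>\<eta> \<rho> i. \<exists>n. X \<eta> \<rho> n \<le> majorant \<xi> (Suc (majorant \<xi> ((h \<xi> ^^ i) 0))) \<and> (h \<xi> ^^ Suc i) 0 \<le> X \<eta> \<rho> (Suc n)"
      by metis
    have "X \<eta> \<rho> \<notin> C \<zeta>" if \<zeta>: "(\<zeta>, \<xi>) \<in> R" for \<eta> \<rho> \<zeta>
    proof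
      assume "X \<eta> \<rho> \<in> C \<zeta>"
      define g where "g n = majorant \<zeta> (h \<zeta> n)" for n
      have "\<zeta> \<in> \<Phi>" using \<zeta> R(3) by blast
      then have g: "mono g" unfolding g_def by (rule gmono)
      have step: "X \<eta> \<rho> (Suc n) \<le> g (X \<eta> \<rho> n)" for n
        using \<open>X \<eta> \<rho> \<in> C \<zeta>\<close> by (simp add: C_def step_bounded_def g_def)
      \<comment> \<open>In this interval the long jump of the branch is longer than \<open>g\<close>
        permits.\<close>
      obtain i where i: "g (majorant \<xi> (Suc (majorant \<xi> ((h \<xi> ^^ i) 0)))) < (h \<xi> ^^ Suc i) 0"
        using esc[OF \<zeta>] unfolding g_def by blast
      obtain n where n: "X \<eta> \<rho> n \<le> majorant \<xi> (Suc (majorant \<xi> ((h \<xi> ^^ i) 0)))"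
          "(h \<xi> ^^ Suc i) 0 \<le> X \<eta> \<rho> (Suc n)"
        using X(4) by blast
      show False using monoD[OF g n(1)] step[of n] i n(2) by linarith
    qed
    moreover have "inj (X \<eta>)" for \<eta>
    proof
      fix \<rho> \<rho>' assume "X \<eta> \<rho> = X \<eta> \<rho>'"
      then have "\<beta> \<eta> \<rho> = \<beta> \<eta> \<rho>'" using X(3) by metis
      then show "\<rho> = \<rho>'" using \<beta>(2) by blast
    qed
    moreover have "F \<xi> (X \<eta> \<rho>) = \<eta>" for \<eta> \<rho> by (simp add: F_def X(3) \<beta>)
    ultimately show "\<exists>\<xi>\<in>\<Phi>. \<exists>X. \<forall>\<eta>. inj (X \<eta>) \<and>
      (\<forall>\<rho> :: nat set. X \<eta> \<rho> \<in> branches T \<inter> C \<xi> \<and> F \<xi> (X \<eta> \<rho>) = \<eta> \<and> (\<forall>\<zeta>. (\<zeta>, \<xi>) \<in> R \<longrightarrow> X \<eta> \<rho> \<notin> C \<zeta>))"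
      using \<xi>(1) X(1,2) by (intro bexI[of _ \<xi>] exI[of _ X]) simp_all
  qed
  then show ?thesis by blast
qed

subsection \<open>Thin Sacks trees\<close>

text \<open>In a Cantor scheme the even bits are fixed to spell \<open>\<rho>\<close> while the odd
  bits stay free, which leaves uncountably many points for each \<open>\<rho>\<close>.\<close>

lemma disjoint_sacks_subtrees:
  assumes S: "S \<in> sacks_trees"
  obtains U :: "nat set \<Rightarrow> nat list set" where "\<And>\<rho>. U \<rho> \<in> sacks_trees" and "\<And>\<rho>. U \<rho> \<subseteq> S"
    and "\<And>\<rho> \<sigma> x. x \<in> branches (U \<rho>) \<Longrightarrow> x \<in> branches (U \<sigma>) \<Longrightarrow> \<rho> = \<sigma>"
proof -
  obtain e :: "nat set \<Rightarrow> nat \<Rightarrow> nat" and M where e: "\<forall>\<beta>. e \<beta> \<in> branches S" "\<forall>\<beta> n. e \<beta> n \<le> M n"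
      and inj_e: "\<forall>m. \<exists>N. \<forall>\<beta> \<gamma>. (\<forall>i<N. e \<beta> i = e \<gamma> i) \<longrightarrow> (\<forall>i<m. i \<in> \<beta> \<longleftrightarrow> i \<in> \<gamma>)"
    using cantor_scheme[OF S] by (elim exE conjE)
  define A where "A \<rho> = {e \<beta> |\<beta>. \<forall>i. 2 * i \<in> \<beta> \<longleftrightarrow> i \<in> \<rho>}" for \<rho>
  define U where "U \<rho> = cond_tree (A \<rho>)" for \<rho>
  have AS: "A \<rho> \<subseteq> branches S" for \<rho> using e(1) by (auto simp: A_def)
  have "uncountable (A \<rho>)" for \<rho>
  proof
    assume "countable (A \<rho>)"
    define b where "b \<sigma> = {i. if even i then i div 2 \<in> \<rho> else i div 2 \<in> \<sigma>}" for \<sigma> :: "nat set"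
    have "range (\<lambda>\<sigma>. e (b \<sigma>)) \<subseteq> A \<rho>" by (auto simp: A_def b_def)
    then have "countable (range (\<lambda>\<sigma>. e (b \<sigma>)))" using \<open>countable (A \<rho>)\<close> countable_subset by blast
    moreover have "inj (\<lambda>\<sigma>. e (b \<sigma>))"
    proof
      fix \<sigma> \<tau> assume eq: "e (b \<sigma>) = e (b \<tau>)"
      have "i \<in> \<sigma> \<longleftrightarrow> i \<in> \<tau>" for i
      proof -
        obtain N where "\<forall>\<beta> \<gamma>. (\<forall>j<N. e \<beta> j = e \<gamma> j) \<longrightarrow> (\<forall>j<Suc (Suc (2 * i)). j \<in> \<beta> \<longleftrightarrow> j \<in> \<gamma>)"
          using inj_e by blast
        then have "Suc (2 * i) \<in> b \<sigma> \<longleftrightarrow> Suc (2 * i) \<in> b \<tau>" using eq by simp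
        then show ?thesis by (simp add: b_def)
      qed
      then show "\<sigma> = \<tau>" by blast
    qed
    ultimately show False using uncountable_UNIV_nat_set by (simp add: countable_image_inj_eq)
  qed
  then have "U \<rho> \<in> sacks_trees" for \<rho>
    unfolding U_def using AS by (intro cond_tree_sacks) (auto simp: branches_def)
  moreover have "U \<rho> \<subseteq> S" for \<rho> unfolding U_def by (rule cond_tree_subset[OF AS])
  moreover have "\<rho> = \<sigma>" if x: "x \<in> branches (U \<rho>)" "x \<in> branches (U \<sigma>)" for \<rho> \<sigma> x
  proof -
    have "i \<in> \<rho> \<longleftrightarrow> i \<in> \<sigma>" for i
    proof -
      \<comment> \<open>\<open>x\<close> is only a limit of points of the scheme; approximations
        from both sides that agree up to \<open>N\<close> share the bit in question.\<close>
      obtain N where N: "\<forall>\<beta> \<gamma>. (\<forall>j<N. e \<beta> j = e \<gamma> j) \<longrightarrow> (\<forall>j<Suc (2 * i). j \<in> \<beta> \<longleftrightarrow> j \<in> \<gamma>)"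
        using inj_e by blast
      obtain \<beta> where \<beta>: "\<forall>j<N. e \<beta> j = x j" "\<forall>i. 2 * i \<in> \<beta> \<longleftrightarrow> i \<in> \<rho>"
        using cond_tree_closure[of x "A \<rho>" N] x(1) unfolding U_def A_def by blast
      obtain \<gamma> where \<gamma>: "\<forall>j<N. e \<gamma> j = x j" "\<forall>i. 2 * i \<in> \<gamma> \<longleftrightarrow> i \<in> \<sigma>"
        using cond_tree_closure[of x "A \<sigma>" N] x(2) unfolding U_def A_def by blast
      have "\<forall>j<N. e \<beta> j = e \<gamma> j" using \<beta>(1) \<gamma>(1) by simp
      then have "2 * i \<in> \<beta> \<longleftrightarrow> 2 * i \<in> \<gamma>" using N by blast
      then show ?thesis using \<beta>(2) \<gamma>(2) by blast
    qed
    then show ?thesis by blast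
  qed
  ultimately show ?thesis using that[of U] by blast
qed

text \<open>The union is countable if \<open>I\<close> is, and has size at most \<open>|I|\<close>
  otherwise.\<close>

lemma small_Union_countable:
  fixes A :: "'i \<Rightarrow> nat set set"
  assumes I: "|I| <o |UNIV :: nat set set|" and A: "\<And>i. i \<in> I \<Longrightarrow> countable (A i)"
  shows "(\<Union>i\<in>I. A i) \<noteq> UNIV"
proof (cases "countable I")
  case True
  then have "countable (\<Union>i\<in>I. A i)" using A by blast
  then show ?thesis using uncountable_UNIV_nat_set by metis
next
  case False
  then have inf: "infinite I" using countable_finite by blast
  have "|A i| \<le>o |I|" if "i \<in> I" for i
  proof -
    obtain f :: "nat set \<Rightarrow> nat" where "inj_on f (A i)" using A[OF \<open>i \<in> I\<close>] by (auto simp: countable_def)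
    then have "|A i| \<le>o |UNIV :: nat set|" by (intro card_of_ordLeqI) auto
    also have "|UNIV :: nat set| \<le>o |I|" using inf infinite_iff_card_of_nat by blast
    finally show ?thesis .
  qed
  then have "|\<Union>i\<in>I. A i| \<le>o |I|"
    by (intro card_of_UNION_ordLeq_infinite[OF inf ordIso_imp_ordLeq[OF card_of_refl]] ballI)
  then have "|\<Union>i\<in>I. A i| <o |UNIV :: nat set set|" using I by (rule ordLeq_ordLess_trans)
  then show ?thesis by (metis not_ordLess_ordIso card_of_refl)
qed

context stratification
begin

definition thin :: "'i \<Rightarrow> nat list set \<Rightarrow> bool" where
  "thin \<xi> S \<longleftrightarrow> branches S \<subseteq> C \<xi> \<and> (\<forall>\<zeta>. (\<zeta>, \<xi>) \<in> R \<longrightarrow> countable (branches S \<inter> C \<zeta>)) \<and>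
     ((\<exists>\<eta>. \<forall>x\<in>branches S. F \<xi> x = \<eta>) \<or> (\<forall>\<eta>. countable {x \<in> branches S. F \<xi> x = \<eta>}))"

text \<open>A Cantor scheme in \<open>S\<close> is bounded, so some level meets
  \<open>branches S\<close> in an uncountable set. Condensation at the least such level stays in
  \<open>C \<xi>\<close> by closedness; if a fibre of \<open>F \<xi>\<close> is still uncountable,
  condensing it makes \<open>F \<xi>\<close> constant by continuity.\<close>

lemma thin_subtree:
  assumes S: "S \<in> sacks_trees"
  obtains \<xi> S' where "\<xi> \<in> \<Phi>" and "S' \<in> sacks_trees" and "S' \<subseteq> S" and "thin \<xi> S'"
proof -
  have inc: "branches U \<subseteq> inc_inf_seqs" for U by (auto simp: branches_def)
  obtain e :: "nat set \<Rightarrow> nat \<Rightarrow> nat" and M where e: "\<forall>\<beta>. e \<beta> \<in> branches S" "\<forall>\<beta> n. e \<beta> n \<le> M n"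
      and inj_e: "\<forall>m. \<exists>N. \<forall>\<beta> \<gamma>. (\<forall>i<N. e \<beta> i = e \<gamma> i) \<longrightarrow> (\<forall>i<m. i \<in> \<beta> \<longleftrightarrow> i \<in> \<gamma>)"
    using cantor_scheme[OF S] by (elim exE conjE)
  have "inj e"
  proof
    fix \<beta> \<gamma> assume "e \<beta> = e \<gamma>"
    have "i \<in> \<beta> \<longleftrightarrow> i \<in> \<gamma>" for i
    proof -
      obtain N where "\<forall>\<beta> \<gamma>. (\<forall>i<N. e \<beta> i = e \<gamma> i) \<longrightarrow> (\<forall>j<Suc i. j \<in> \<beta> \<longleftrightarrow> j \<in> \<gamma>)"
        using inj_e by blast
      then show ?thesis using \<open>e \<beta> = e \<gamma>\<close> by auto
    qed
    then show "\<beta> = \<gamma>" by blast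
  qed
  then have unc: "uncountable (range e)"
    using uncountable_UNIV_nat_set by (simp add: countable_image_inj_eq)
  obtain \<xi>0 where \<xi>0: "\<xi>0 \<in> \<Phi>" "{x \<in> inc_inf_seqs. \<forall>n. x n \<le> M n} \<subseteq> C \<xi>0" using bounded by blast
  have "range e \<subseteq> branches S \<inter> C \<xi>0" using e inc \<xi>0(2) by blast
  then have "uncountable (branches S \<inter> C \<xi>0)" using unc countable_subset by blast
  define Z where "Z = {\<xi> \<in> \<Phi>. uncountable (branches S \<inter> C \<xi>)}"
  have "\<xi>0 \<in> Z" using \<xi>0(1) \<open>uncountable (branches S \<inter> C \<xi>0)\<close> by (simp add: Z_def)
  from wf[unfolded wf_eq_minimal, rule_format, OF this]
  obtain \<xi> where "\<xi> \<in> Z" and min: "\<forall>\<zeta>. (\<zeta>, \<xi>) \<in> R \<longrightarrow> \<zeta> \<notin> Z" by (elim bexE)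
  then have \<xi>: "\<xi> \<in> \<Phi>" "uncountable (branches S \<inter> C \<xi>)" by (simp_all add: Z_def)
  have least: "countable (branches S \<inter> C \<zeta>)" if "(\<zeta>, \<xi>) \<in> R" for \<zeta>
    using min that subset by (auto simp: Z_def)
  define U where "U = cond_tree (branches S \<inter> C \<xi>)"
  have U: "U \<in> sacks_trees" "U \<subseteq> S"
    unfolding U_def using \<xi>(2) inc by (intro cond_tree_sacks cond_tree_subset; blast)+
  have UC: "branches U \<subseteq> C \<xi>"
  proof
    fix x assume x: "x \<in> branches U"
    show "x \<in> C \<xi>"
    proof (rule closed)
      show "x \<in> inc_inf_seqs" using x inc by blast
      show "\<exists>y\<in>C \<xi>. \<forall>i<n. y i = x i" for n
        using cond_tree_closure[of x "branches S \<inter> C \<xi>" n] x unfolding U_def by blast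
    qed
  qed
  have small: "countable (branches W \<inter> C \<zeta>)" if "W \<subseteq> U" "(\<zeta>, \<xi>) \<in> R" for W \<zeta>
    using least[OF that(2)] branches_mono[of W S] that(1) U(2) countable_subset
    by (metis inf_mono order.refl order.trans)
  show ?thesis
  proof (cases "\<forall>\<eta>. countable {x \<in> branches U. F \<xi> x = \<eta>}")
    case True
    then have "thin \<xi> U" using UC small[of U] by (simp add: thin_def)
    then show ?thesis using that \<xi>(1) U by blast
  next
    case False
    then obtain \<eta> where \<eta>: "uncountable {x \<in> branches U. F \<xi> x = \<eta>}" by blast
    define W where "W = cond_tree {x \<in> branches U. F \<xi> x = \<eta>}"
    have W: "W \<in> sacks_trees" "W \<subseteq> U"
      unfolding W_def using \<eta> inc by (intro cond_tree_sacks cond_tree_subset; blast)+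
    have "F \<xi> x = \<eta>" if x: "x \<in> branches W" for x
    proof -
      have "i \<in> F \<xi> x \<longleftrightarrow> i \<in> \<eta>" for i
      proof -
        obtain N where N: "\<forall>x\<in>inc_inf_seqs. \<forall>y\<in>inc_inf_seqs. (\<forall>k<N. x k = y k) \<longrightarrow> (i \<in> F \<xi> x \<longleftrightarrow> i \<in> F \<xi> y)"
          using continuous by blast
        obtain y where "y \<in> branches U" "F \<xi> y = \<eta>" "\<forall>k<N. y k = x k"
          using cond_tree_closure[of x "{x \<in> branches U. F \<xi> x = \<eta>}" N] x unfolding W_def by blast
        moreover have "x \<in> inc_inf_seqs" "y \<in> inc_inf_seqs" using x \<open>y \<in> branches U\<close> inc by blast+
        ultimately show ?thesis using N by blast
      qed
      then show ?thesis by blast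
    qed
    moreover have "branches W \<subseteq> C \<xi>" using branches_mono[OF W(2)] UC by blast
    ultimately have "thin \<xi> W" using small[OF W(2)] by (auto simp: thin_def)
    then show ?thesis using that \<xi>(1) W U(2) by blast
  qed
qed

text \<open>Two successive choices: first a code \<open>\<eta>\<close> that no tree of
  \<open>\<S>\<close> has as the constant value of \<open>F \<xi>\<close>, then a
  \<open>\<rho>\<close> avoiding the countably many bad ones per tree.\<close>

lemma miller_avoids_thin:
  assumes T: "T \<in> miller_trees" and \<S>: "|\<S>| <o |UNIV :: nat set set|"
    and thin: "\<And>S. S \<in> \<S> \<Longrightarrow> \<exists>\<xi>\<in>\<Phi>. thin \<xi> S"
  shows "\<exists>x\<in>branches T. \<forall>S\<in>\<S>. x \<notin> branches S"
proof -
  obtain \<xi> X where \<xi>: "\<xi> \<in> \<Phi>"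
      and all: "\<forall>\<eta>. inj (X \<eta>) \<and> (\<forall>\<rho> :: nat set. X \<eta> \<rho> \<in> branches T \<inter> C \<xi> \<and> F \<xi> (X \<eta> \<rho>) = \<eta> \<and>
        (\<forall>\<zeta>. (\<zeta>, \<xi>) \<in> R \<longrightarrow> X \<eta> \<rho> \<notin> C \<zeta>))"
    using miller_rich[OF T] by (elim bexE exE)
  have X: "inj (X \<eta>)" "X \<eta> \<rho> \<in> branches T" "X \<eta> \<rho> \<in> C \<xi>" "F \<xi> (X \<eta> \<rho>) = \<eta>" for \<eta> \<rho>
    using all by auto
  have escape: "X \<eta> \<rho> \<notin> C \<zeta>" if "(\<zeta>, \<xi>) \<in> R" for \<eta> \<rho> \<zeta>
    using all that by auto
  \<comment> \<open>The values of \<open>F \<xi>\<close> that are ruled out because \<open>F \<xi>\<close> is constant on \<open>S\<close>.\<close>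
  define K where "K S = (if \<exists>\<eta>. \<forall>x\<in>branches S. F \<xi> x = \<eta> then F \<xi> ` branches S else {})" for S
  have "countable (K S)" for S
  proof (cases "\<exists>\<eta>. \<forall>x\<in>branches S. F \<xi> x = \<eta>")
    case True
    then obtain \<eta> where "F \<xi> ` branches S \<subseteq> {\<eta>}" by blast
    then have "countable (F \<xi> ` branches S)" by (rule countable_subset) simp
    then show ?thesis by (simp add: K_def)
  next
    case False
    then have "K S = {}" unfolding K_def by (rule if_not_P)
    then show ?thesis by simp
  qed
  then obtain \<eta> where \<eta>: "\<And>S. S \<in> \<S> \<Longrightarrow> \<eta> \<notin> K S"
    using small_Union_countable[OF \<S>, of K] by blast
  have "countable {\<rho>. X \<eta> \<rho> \<in> branches S}" if S: "S \<in> \<S>" for S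
  proof -
    obtain \<zeta> where "\<zeta> \<in> \<Phi>" and "thin \<zeta> S" using thin[OF S] by blast
    then have \<zeta>: "\<zeta> \<in> \<Phi>" "branches S \<subseteq> C \<zeta>" "\<And>\<theta>. (\<theta>, \<zeta>) \<in> R \<Longrightarrow> countable (branches S \<inter> C \<theta>)"
      "(\<exists>\<eta>. \<forall>x\<in>branches S. F \<zeta> x = \<eta>) \<or> (\<forall>\<eta>. countable {x \<in> branches S. F \<zeta> x = \<eta>})"
      unfolding thin_def by simp_all
    have "countable (X \<eta> ` {\<rho>. X \<eta> \<rho> \<in> branches S})"
    proof (cases "\<zeta> = \<xi>")
      case True
      show ?thesis
      proof (cases "\<exists>\<eta>. \<forall>x\<in>branches S. F \<xi> x = \<eta>")
        case True
        then have "F \<xi> x \<noteq> \<eta>" if "x \<in> branches S" for x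
          using \<eta>[OF S] that unfolding K_def by auto
        then have "X \<eta> \<rho> \<notin> branches S" for \<rho> using X(4)[of \<eta> \<rho>] by metis
        then show ?thesis by simp
      next
        case False
        then have "\<forall>\<eta>. countable {x \<in> branches S. F \<xi> x = \<eta>}" 
          using \<zeta>(4) unfolding \<open>\<zeta> = \<xi>\<close> by argo
        then have "countable {x \<in> branches S. F \<xi> x = \<eta>}" by (rule spec)
        then show ?thesis by (rule countable_subset[rotated]) (auto simp: X(4))
      qed
    next
      case False
      \<comment> \<open>If \<open>\<zeta>\<close> is earlier, the points
        \<open>X \<eta> \<rho>\<close> lie outside \<open>C \<zeta>\<close>; if it is later,
        thinness of \<open>S\<close> makes its trace on \<open>C \<xi>\<close> countable.\<close>
      then consider "(\<zeta>, \<xi>) \<in> R" | "(\<xi>, \<zeta>) \<in> R" using total \<xi> \<zeta>(1) by blast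
      then show ?thesis
      proof cases
        case 1
        then have "{\<rho>. X \<eta> \<rho> \<in> branches S} = {}" using escape[of \<zeta>] \<zeta>(2) by auto
        then show ?thesis by simp
      next
        case 2
        from \<zeta>(3)[OF this] show ?thesis by (rule countable_subset[rotated]) (auto simp: X(3))
      qed
    qed
    moreover have "inj_on (X \<eta>) {\<rho>. X \<eta> \<rho> \<in> branches S}" using X(1) inj_on_subset by blast
    ultimately show ?thesis by (rule countable_image_inj_on)
  qed
  then obtain \<rho> where "\<And>S. S \<in> \<S> \<Longrightarrow> X \<eta> \<rho> \<notin> branches S"
    using small_Union_countable[OF \<S>, of "\<lambda>S. {\<rho>. X \<eta> \<rho> \<in> branches S}"] by blast
  then show ?thesis using X(2) by blast
qed

end

section \<open>Transfinite choice of one branch for each Miller tree\<close>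

lemma inc_fin_seqs_miller: "inc_fin_seqs \<in> miller_trees"
proof -
  have "is_tree inc_fin_seqs"
    by (auto simp: is_tree_def inc_fin_seqs_def prefix_def sorted_wrt_append intro!: exI[of _ "[]"])
  moreover have "infinite (imm_succs inc_fin_seqs s)" if "s \<in> inc_fin_seqs" for s
  proof
    assume "finite (imm_succs inc_fin_seqs s)"
    \<comment> \<open>Any number above \<open>sum_list s\<close> exceeds every entry of
      \<open>s\<close>.\<close>
    moreover have "(\<lambda>k. s @ [k]) ` {Suc (sum_list s)..} \<subseteq> imm_succs inc_fin_seqs s"
      using that member_le_sum_list[of _ s]
      by (fastforce simp: imm_succs_def inc_fin_seqs_def sorted_wrt_append)
    ultimately have "finite ((\<lambda>k. s @ [k]) ` {Suc (sum_list s)..})" by (rule finite_subset[rotated])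
    then have "finite {Suc (sum_list s)..}" by (rule finite_imageD) (simp add: inj_on_def)
    then show False using infinite_Ici by blast
  qed
  ultimately show ?thesis by (auto simp: miller_trees_def)
qed

theorem theorem2p2:
  "\<exists>X. X \<subseteq> inc_inf_seqs \<and> X \<in> s0 \<and> X \<notin> m0"
proof -
  obtain \<Phi> :: "(nat \<Rightarrow> nat) set" and R C F where "stratification \<Phi> R C F"
    using stratification_exists by blast
  then interpret stratification \<Phi> R C F .
  \<comment> \<open>A well-order of all sets of nodes whose proper initial segments are smaller than
    the continuum; Miller trees and thin trees are compared in it.\<close>
  define r where "r = |UNIV :: nat list set set|"
  define \<T> where "\<T> = {S. \<exists>\<xi>\<in>\<Phi>. thin \<xi> S}"
  have r_le: "r \<le>o |UNIV :: nat set set|"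
  proof -
    have "inj (image (to_nat :: nat list \<Rightarrow> nat))" by (intro inj_on_image) simp
    then show ?thesis unfolding r_def by (intro card_of_ordLeqI[of "image to_nat"]) auto
  qed
  have underS: "|underS r S| <o |UNIV :: nat set set|" for S
  proof -
    have "|underS r S| <o r"
      unfolding r_def by (intro card_of_underS card_of_Card_order) (simp add: Field_card_of)
    then show ?thesis using r_le by (rule ordLess_ordLeq_trans)
  qed
  have "\<exists>x\<in>branches T. \<forall>S\<in>underS r T \<inter> \<T>. x \<notin> branches S" if "T \<in> miller_trees" for T
  proof (rule miller_avoids_thin[OF that])
    show "|underS r T \<inter> \<T>| <o |UNIV :: nat set set|"
      using card_of_mono1[OF Int_lower1] underS by (rule ordLeq_ordLess_trans)
  qed (auto simp: \<T>_def)
  then obtain p where p: "\<And>T. T \<in> miller_trees \<Longrightarrow> p T \<in> branches T"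
      "\<And>T S. T \<in> miller_trees \<Longrightarrow> S \<in> underS r T \<Longrightarrow> S \<in> \<T> \<Longrightarrow> p T \<notin> branches S"
    by (metis IntI)
  define X where "X = p ` miller_trees"
  have Xinc: "X \<subseteq> inc_inf_seqs" using p(1) by (auto simp: X_def branches_def)
  have "\<exists>S'\<in>sacks_trees. S' \<subseteq> S \<and> branches S' \<inter> X = {}" if S: "S \<in> sacks_trees" for S
  proof -
    obtain \<xi> S1 where S1: "\<xi> \<in> \<Phi>" "S1 \<in> sacks_trees" "S1 \<subseteq> S" "thin \<xi> S1"
      using thin_subtree[OF S] by blast
    then have "S1 \<in> \<T>" by (auto simp: \<T>_def)
    \<comment> \<open>A tree \<open>T\<close> after \<open>S1\<close> had its point chosen off
      \<open>S1\<close>, so only \<open>S1\<close> and its predecessors can contribute.\<close>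
    have "X \<inter> branches S1 \<subseteq> p ` (underS r S1 \<union> {S1})"
    proof
      fix x assume x: "x \<in> X \<inter> branches S1"
      then obtain T where T: "T \<in> miller_trees" "x = p T" by (auto simp: X_def)
      have "S1 \<notin> underS r T" using p(2)[OF T(1)] \<open>S1 \<in> \<T>\<close> x T(2) by blast
      moreover have "total r"
        using card_of_well_order_on[of "UNIV :: nat list set set"]
        by (simp add: r_def well_order_on_def linear_order_on_def)
      ultimately have "T = S1 \<or> T \<in> underS r S1"
        by (auto simp: underS_def total_on_def)
      then show "x \<in> p ` (underS r S1 \<union> {S1})" using T(2) by blast
    qed
    then have "|X \<inter> branches S1| \<le>o |p ` (underS r S1 \<union> {S1})|" by (rule card_of_mono1)
    also have "|p ` (underS r S1 \<union> {S1})| \<le>o |underS r S1 \<union> {S1}|" by (rule card_of_image)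
    finally have le: "|X \<inter> branches S1| \<le>o |underS r S1 \<union> {S1}|" .
    have inf: "infinite (UNIV :: nat set set)" using uncountable_UNIV_nat_set countable_finite by blast
    then have "|underS r S1 \<union> {S1}| <o |UNIV :: nat set set|"
      by (intro card_of_Un_ordLess_infinite underS finite_ordLess_infinite)
        (simp_all add: card_of_well_order_on Field_card_of)
    with le have small: "|X \<inter> branches S1| <o |UNIV :: nat set set|" by (rule ordLeq_ordLess_trans)
    obtain U :: "nat set \<Rightarrow> nat list set" where U: "\<And>\<rho>. U \<rho> \<in> sacks_trees" "\<And>\<rho>. U \<rho> \<subseteq> S1"
      "\<And>\<rho> \<sigma> x. x \<in> branches (U \<rho>) \<Longrightarrow> x \<in> branches (U \<sigma>) \<Longrightarrow> \<rho> = \<sigma>"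
      using disjoint_sacks_subtrees[OF S1(2)] by blast
    \<comment> \<open>Otherwise one point of \<open>X\<close> from each of the disjoint subtrees
      would give continuum many points of \<open>X\<close> on \<open>S1\<close>.\<close>
    have "\<exists>\<rho>. branches (U \<rho>) \<inter> X = {}"
    proof (rule ccontr)
      assume "\<not> ?thesis"
      then have "\<forall>\<rho>. \<exists>x. x \<in> branches (U \<rho>) \<inter> X" by blast
      then obtain y where y: "\<And>\<rho>. y \<rho> \<in> branches (U \<rho>) \<inter> X" by metis
      have "inj y"
      proof
        fix \<rho> \<sigma> assume "y \<rho> = y \<sigma>"
        then show "\<rho> = \<sigma>" using y[of \<rho>] y[of \<sigma>] U(3)[of "y \<rho>" \<rho> \<sigma>] by simp
      qed
      moreover have "y \<rho> \<in> X \<inter> branches S1" for \<rho> using y branches_mono[OF U(2)] by blast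
      ultimately have "|UNIV :: nat set set| \<le>o |X \<inter> branches S1|"
        by (intro card_of_ordLeqI[of y]) auto
      then show False using small not_ordLess_ordLeq by blast
    qed
    then show ?thesis using U(1,2) S1(3) by (meson subset_trans)
  qed
  then have "X \<in> s0" using Xinc by (simp add: s0_def assoc_ideal_def)
  moreover have "X \<notin> m0"
  proof
    assume "X \<in> m0"
    \<comment> \<open>Membership in the ideal is tested at the full tree; the resulting
      \<open>T\<close> contradicts the choice of \<open>p T\<close>.\<close>
    then obtain T where "T \<in> miller_trees" "branches T \<inter> X = {}"
      using inc_fin_seqs_miller unfolding m0_def assoc_ideal_def by blast
    then show False using p(1) by (auto simp: X_def)
  qed
  ultimately show ?thesis using Xinc by blast
qed

end
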